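(* Let $A$ be a commutative unital ring, let $\beta$ be a finite sequence of monomials in $A[t_1,\ldots,t_n]$ containing all divisors of its members, let $N=|\beta|$, fix an integer $d\ge d(\beta)+1$, and let $\hat\beta$ be a lift of $\beta$ to $A\langle t_1,\ldots,t_n\rangle$. Let $J'\subseteq A[z]\langle x_1,\ldots,x_n\rangle$ be a graded left ideal, let $J\subseteq A[z,x_1,\ldots,x_n]$ denote its image under the canonical map, and let $I\subseteq A\langle t_1,\ldots,t_n\rangle$ denote the left ideal obtained from $J'$ by localization in $z$ and taking out degree zero elements. Assume the following. (1) The graded ideal $J\subseteq A[z,x_1,\ldots,x_n]$ is generated by elements of degree $d$. (2) The sequence $z^d\beta$ forms a basis for the $A$-module $E^J_d=(A[z,x_1,\ldots,x_n]/J)_d$. (3) The sequence $\hat\beta$ forms a basis for the $A$-module $A\langle t_1,\ldots,t_n\rangle/I$. Then we have the equality of ideals $$\mathcal{F}itt_{N-1}(E^J_{d+m})=([T_i,T_j])_{1\le i,j\le n}\quad\text{in } A,$$ for all $m\ge1$.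
   Context: "Containing all divisors" means: if $\lambda\in\beta$ and $\lambda=t_i^{e}\lambda'$ with $e\ge1$, $1\le i\le n$, then $t_i^{e-1}\lambda'\in\beta$. $d(\beta)$ is the maximal degree of the monomials in $\beta$, and $z^d\beta=\{z^d\lambda\mid\lambda\in\beta\}$, viewed as degree $d$ monomials in the standard graded polynomial ring $A[z,x_1,\ldots,x_n]$ via $t_i=x_i/z$. $A\langle t_1,\ldots,t_n\rangle$ is the free non-commutative $A$-algebra, and $A[z]\langle x_1,\ldots,x_n\rangle$ is the free $A[z]$-algebra in $x_1,\ldots,x_n$ (so $z$ commutes with every $x_i$), graded with $\deg z=\deg x_1=\cdots=\deg x_n=1$. Localizing it in $z$ and taking the degree zero part gives $A\langle t_1,\ldots,t_n\rangle$ with $t_i=x_i/z$. The canonical maps are the quotient maps $A\langle t_1,\ldots,t_n\rangle\to A[t_1,\ldots,t_n]$ and $A[z]\langle x_1,\ldots,x_n\rangle\to A[z,x_1,\ldots,x_n]$. A lift of a monomial $\lambda\in A[t_1,\ldots,t_n]$ is a monomial word in $A\langle t_1,\ldots,t_n\rangle$ mapping to $\lambda$; a lift $\hat\beta$ of $\beta$ is a sequence consisting of one lift of each element of $\beta$. $T_i$ is the $(N\times N)$-matrix over $A$, in the basis $\hat\beta$, of left multiplication by $t_i$ on the left module $A\langle t_1,\ldots,t_n\rangle/I$. $[T_i,T_j]=T_iT_j-T_jT_i$, and $([T_i,T_j])_{1\le i,j\le n}$ is the commutator ideal of $A$ generated by all entries of all these matrices. $E^J_m=(A[z,x_1,\ldots,x_n]/J)_m$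 is the degree $m$ part, and $\mathcal{F}itt_{N-1}(E)\subseteq A$ denotes the $(N-1)$'th Fitting ideal of a finitely generated $A$-module $E$. *)

theory Defs
  imports
    "HOL-Library.Poly_Mapping"
    "HOL-Computational_Algebra.Polynomial"
    "Jordan_Normal_Form.Determinant"
    "Jordan_Normal_Form.DL_Submatrix"
begin

text \<open>
  The rings are monoid algebras in the sense of \<^theory>\<open>HOL-Library.Poly_Mapping\<close>, the variables
  being indexed by a finite type \<open>'n\<close>:
  \<^item> \<open>A[t]\<close> is \<open>('n \<Rightarrow>\<^sub>0 nat) \<Rightarrow>\<^sub>0 'a\<close>; its monomials are the exponent vectors \<open>'n \<Rightarrow>\<^sub>0 nat\<close>.
  \<^item> \<open>A[z,x]\<close> is \<open>('n hvar \<Rightarrow>\<^sub>0 nat) \<Rightarrow>\<^sub>0 'a\<close>.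
  \<^item> \<open>A\<langle>t\<rangle>\<close> is \<open>'n fword \<Rightarrow>\<^sub>0 'a\<close>, where \<open>'n fword\<close> is the free monoid on \<open>'n\<close>.
  \<^item> \<open>A[z]\<langle>x\<rangle>\<close> is \<open>'n fword \<Rightarrow>\<^sub>0 'a poly\<close>, with \<open>A[z]\<close> the univariate polynomial ring \<open>'a poly\<close>.
\<close>

datatype 'n fword = Word (letters: "'n list")

instantiation fword :: (type) monoid_add
begin

definition zero_fword :: "'a fword" where
  "0 = Word []"

definition plus_fword :: "'a fword \<Rightarrow> 'a fword \<Rightarrow> 'a fword" where
  "u + v = Word (letters u @ letters v)"

instance
  by standard (auto simp: zero_fword_def plus_fword_def)

end

datatype 'n hvar = Z | X 'n

type_synonym 'n monomial = "'n \<Rightarrow>\<^sub>0 nat"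
type_synonym ('n, 'a) comm_poly = "('n \<Rightarrow>\<^sub>0 nat) \<Rightarrow>\<^sub>0 'a"
type_synonym ('n, 'a) hom_comm_poly = "('n hvar \<Rightarrow>\<^sub>0 nat) \<Rightarrow>\<^sub>0 'a"
type_synonym ('n, 'a) free_alg = "'n fword \<Rightarrow>\<^sub>0 'a"
type_synonym ('n, 'a) hom_free_alg = "'n fword \<Rightarrow>\<^sub>0 'a poly"

definition const :: "'a::comm_ring_1 \<Rightarrow> ('m::monoid_add \<Rightarrow>\<^sub>0 'a)" where
  "const c = Poly_Mapping.single 0 c"

definition scale :: "'a::comm_ring_1 \<Rightarrow> ('m::monoid_add \<Rightarrow>\<^sub>0 'a) \<Rightarrow> ('m \<Rightarrow>\<^sub>0 'a)" where
  "scale c f = const c * f"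

definition mon :: "'m \<Rightarrow> ('m \<Rightarrow>\<^sub>0 'a::comm_ring_1)" where
  "mon u = Poly_Mapping.single u 1"

definition var :: "'v \<Rightarrow> (('v \<Rightarrow>\<^sub>0 nat) \<Rightarrow>\<^sub>0 'a::comm_ring_1)" where
  "var i = mon (Poly_Mapping.single i 1)"

definition free_var :: "'n \<Rightarrow> ('n, 'a::comm_ring_1) free_alg" where
  "free_var i = mon (Word [i])"

definition mdeg :: "('v \<Rightarrow>\<^sub>0 nat) \<Rightarrow> nat" where
  "mdeg u = (\<Sum>i\<in>Poly_Mapping.keys u. Poly_Mapping.lookup u i)"

definition left_ideal :: "'r::ring_1 set \<Rightarrow> bool" where
  "left_ideal I \<longleftrightarrow> 0 \<in> I \<and> (\<forall>x\<in>I. \<forall>y\<in>I. x + y \<in> I) \<and> (\<forall>r. \<forall>x\<in>I. r * x \<in> I)"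

definition ideal_gen :: "'r::comm_ring_1 set \<Rightarrow> 'r set" where
  "ideal_gen S = left_ideal hull S"

definition comm_image :: "('n, 'a::comm_ring_1) free_alg \<Rightarrow> ('n, 'a) comm_poly" where
  "comm_image f =
     (\<Sum>w\<in>Poly_Mapping.keys f. const (Poly_Mapping.lookup f w) * prod_list (map var (letters w)))"

definition hom_comm_image :: "('n, 'a::comm_ring_1) hom_free_alg \<Rightarrow> ('n, 'a) hom_comm_poly" where
  "hom_comm_image g =
     (\<Sum>w\<in>Poly_Mapping.keys g.
        poly (map_poly const (Poly_Mapping.lookup g w)) (var Z)
        * prod_list (map (\<lambda>i. var (X i)) (letters w)))"

definition hom_comm_part :: "nat \<Rightarrow> ('n, 'a::comm_ring_1) hom_comm_poly set" where
  "hom_comm_part m = {f. \<forall>u\<in>Poly_Mapping.keys f. mdeg u = m}"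

definition hom_free_part :: "nat \<Rightarrow> ('n, 'a::comm_ring_1) hom_free_alg set" where
  "hom_free_part m =
     {g. \<forall>w k. coeff (Poly_Mapping.lookup g w) k \<noteq> 0 \<longrightarrow> k + length (letters w) = m}"

definition graded_left_ideal :: "('n, 'a::comm_ring_1) hom_free_alg set \<Rightarrow> bool" where
  "graded_left_ideal J \<longleftrightarrow> left_ideal J \<and>
     (\<forall>g\<in>J. \<exists>k h. (\<forall>m. h m \<in> J \<inter> hom_free_part m) \<and> g = (\<Sum>m<k. h m))"

definition generated_in_degree :: "nat \<Rightarrow> ('n, 'a::comm_ring_1) hom_comm_poly set \<Rightarrow> bool" where
  "generated_in_degree d J \<longleftrightarrow> (\<exists>G \<subseteq> hom_comm_part d. J = ideal_gen G)"

text \<open>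
  A degree zero element of the localization of \<open>A[z]\<langle>x\<rangle>\<close> in \<open>z\<close> has the form \<open>g / z^e\<close> with \<open>g\<close>
  homogeneous of degree \<open>e\<close>. As \<open>x\<^sub>i = z t\<^sub>i\<close>, a monomial \<open>c z^(e-r) x\<^sub>i\<^sub>1 \<cdots> x\<^sub>i\<^sub>r\<close> of \<open>g\<close> becomes
  \<open>c t\<^sub>i\<^sub>1 \<cdots> t\<^sub>i\<^sub>r\<close>, so that \<open>g / z^e\<close> is the element of \<open>A\<langle>t\<rangle>\<close> obtained from \<open>g\<close> by evaluating its
  coefficients at \<open>z = 1\<close>.
\<close>

definition dehomogenize :: "('n, 'a::comm_ring_1) hom_free_alg \<Rightarrow> ('n, 'a) free_alg" where
  "dehomogenize g = Poly_Mapping.map (\<lambda>p. poly p 1) g"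

definition degree_zero_localization ::
    "('n, 'a::comm_ring_1) hom_free_alg set \<Rightarrow> ('n, 'a) free_alg set" where
  "degree_zero_localization J = {dehomogenize g | g e. g \<in> J \<and> g \<in> hom_free_part e}"

definition contains_divisors :: "'n monomial list \<Rightarrow> bool" where
  "contains_divisors \<beta> \<longleftrightarrow>
     (\<forall>l\<in>set \<beta>. \<forall>i e l'. e \<ge> 1 \<and> l = Poly_Mapping.single i e + l' \<longrightarrow>
        Poly_Mapping.single i (e - 1) + l' \<in> set \<beta>)"

text \<open>The maximal degree of the empty sequence is taken to be \<open>0\<close>.\<close>

definition max_deg :: "'n monomial list \<Rightarrow> nat" where
  "max_deg \<beta> = Max (insert 0 (mdeg ` set \<beta>))"

definition is_lift :: "'a::comm_ring_1 itself \<Rightarrow> 'n fword list \<Rightarrow> 'n monomial list \<Rightarrow> bool" where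
  "is_lift TA \<beta>h \<beta> \<longleftrightarrow>
     list_all2 (\<lambda>w l. comm_image (mon w :: ('n, 'a) free_alg) = mon l) \<beta>h \<beta>"

definition homogenize_mono ::
    "nat \<Rightarrow> 'n::finite monomial \<Rightarrow> ('n, 'a::comm_ring_1) hom_comm_poly" where
  "homogenize_mono d l =
     var Z ^ (d - mdeg l) * (\<Prod>i\<in>UNIV. var (X i) ^ Poly_Mapping.lookup l i)"

text \<open>
  For a scalar multiplication \<open>s\<close> of \<open>A\<close> on \<open>'b\<close> and submodules \<open>M\<close> and \<open>S\<close> of \<open>'b\<close>, the following
  concern the \<open>A\<close>-module \<open>E\<close> of all classes modulo \<open>S\<close> of elements of \<open>M\<close>. With \<open>M\<close> the degree \<open>m\<close>
  part of \<open>A[z,x]\<close> and \<open>S = J\<close>, this \<open>E\<close> is the degree \<open>m\<close> part of \<open>A[z,x]/J\<close>. Elements of \<open>E\<close>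
  are given by representatives in \<open>M\<close>.
\<close>

definition lincomb :: "('a \<Rightarrow> 'b \<Rightarrow> 'b::ab_group_add) \<Rightarrow> 'b list \<Rightarrow> 'a vec \<Rightarrow> 'b" where
  "lincomb s gs c = (\<Sum>i<length gs. s (c $ i) (gs ! i))"

definition generates ::
    "('a \<Rightarrow> 'b \<Rightarrow> 'b::ab_group_add) \<Rightarrow> 'b set \<Rightarrow> 'b set \<Rightarrow> 'b list \<Rightarrow> bool" where
  "generates s M S gs \<longleftrightarrow>
     set gs \<subseteq> M \<and> (\<forall>v\<in>M. \<exists>c\<in>carrier_vec (length gs). v - lincomb s gs c \<in> S)"

definition relations ::
    "('a \<Rightarrow> 'b \<Rightarrow> 'b::ab_group_add) \<Rightarrow> 'b set \<Rightarrow> 'b list \<Rightarrow> 'a vec set" where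
  "relations s S gs = {c \<in> carrier_vec (length gs). lincomb s gs c \<in> S}"

definition is_basis ::
    "('a::comm_ring_1 \<Rightarrow> 'b \<Rightarrow> 'b::ab_group_add) \<Rightarrow> 'b set \<Rightarrow> 'b set \<Rightarrow> 'b list \<Rightarrow> bool" where
  "is_basis s M S bs \<longleftrightarrow> generates s M S bs \<and> relations s S bs = {0\<^sub>v (length bs)}"

text \<open>
  For generators \<open>g\<^sub>1, \<dots>, g\<^sub>p\<close> of \<open>E\<close>, the \<open>k\<close>'th Fitting ideal is generated by the \<open>(p-k)\<close>-minors
  of the matrix whose rows are all the relations among the \<open>g\<^sub>i\<close>; it does not depend on the
  generators. The index \<open>k\<close> is an integer: there are no minors of size larger than \<open>p\<close>, so the
  ideal is zero for \<open>k < 0\<close>, and minors of size at most \<open>0\<close> are \<open>1\<close>.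
\<close>

definition relation_minors ::
    "('a::comm_ring_1 \<Rightarrow> 'b \<Rightarrow> 'b::ab_group_add) \<Rightarrow> 'b set \<Rightarrow> 'b list \<Rightarrow> nat \<Rightarrow> 'a set" where
  "relation_minors s S gs r =
     {det (submatrix (mat_of_rows (length gs) rs) UNIV C) | rs C.
        set rs \<subseteq> relations s S gs \<and> length rs = r \<and> C \<subseteq> {..<length gs} \<and> card C = r}"

definition fitting_ideal ::
    "('a::comm_ring_1 \<Rightarrow> 'b \<Rightarrow> 'b::ab_group_add) \<Rightarrow> 'b set \<Rightarrow> 'b set \<Rightarrow> int \<Rightarrow> 'a set" where
  "fitting_ideal s M S k =
     (let gs = (SOME gs. generates s M S gs)
      in ideal_gen (relation_minors s S gs (nat (int (length gs) - k))))"

definition matrix_in_basis ::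
    "('a::comm_ring_1 \<Rightarrow> 'b \<Rightarrow> 'b::ab_group_add) \<Rightarrow> 'b set \<Rightarrow> 'b list \<Rightarrow> ('b \<Rightarrow> 'b) \<Rightarrow> 'a mat" where
  "matrix_in_basis s S bs \<phi> =
     (THE T. T \<in> carrier_mat (length bs) (length bs) \<and>
        (\<forall>j<length bs. \<phi> (bs ! j) - lincomb s bs (col T j) \<in> S))"

definition mult_matrix ::
    "('n, 'a::comm_ring_1) free_alg set \<Rightarrow> 'n fword list \<Rightarrow> 'n \<Rightarrow> 'a mat" where
  "mult_matrix I \<beta>h i = matrix_in_basis scale I (map mon \<beta>h) (\<lambda>f. free_var i * f)"

definition commutator_ideal :: "nat \<Rightarrow> ('n \<Rightarrow> 'a::comm_ring_1 mat) \<Rightarrow> 'a set" where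
  "commutator_ideal N T =
     ideal_gen {(T i * T j - T j * T i) $$ (a, b) | i j a b. a < N \<and> b < N}"

end

theory Submission
  imports Defs
begin

text \<open>
  Both ideals measure how far the \<open>A\<close>-module spanned by \<open>\<beta>\<close> is from carrying commuting
  multiplications by the \<open>t\<^sub>i\<close>.

  Write \<open>E\<^sub>e\<close> for the degree \<open>e\<close> part of \<open>A[z,x]/J\<close>. Every member of \<open>\<beta>\<close> has degree less than \<open>d\<close>,
  so each \<open>x\<^sub>i z\<^sup>d l\<close> with \<open>l\<close> in \<open>\<beta>\<close> is \<open>z\<close> times an element of degree \<open>d\<close>. Hence multiplication by
  \<open>z\<close> maps \<open>E\<^sub>e\<close> onto the next part for \<open>e \<ge> d\<close>, and \<open>z\<^sup>e\<beta>\<close> generates \<open>E\<^sub>e\<close> (\<open>generates_above\<close>). For a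
  module with a generating sequence of length \<open>N\<close>, the Fitting ideal of index \<open>N - 1\<close> is generated by
  the entries of the relations of that sequence, even if it is computed from other generators
  (\<open>fitting_ideal_pred_generators\<close>). It remains to compare these entries, in a degree above \<open>d\<close>, with
  the entries of the commutators of the \<open>T\<^sub>i\<close>.

  The comparison rests on one construction (\<open>commuting_action\<close>). Let matrices commute modulo an
  ideal of \<open>A\<close>, and fix a starting vector. Modulo that ideal, the vector that results from applying
  a word of matrices depends only on the underlying monomial. So words define a map on the free algebra,
  monomials define a map on \<open>A[z,x]\<close> in which \<open>z\<close> acts as the identity, and the two maps agree along the
  canonical map and the dehomogenization (\<open>free_value_dehomogenize\<close>). It is used twice.

  \<^item> With the matrices \<open>T\<^sub>i\<close>, the coordinates of \<open>1\<close> and the commutator ideal, the map on the free algebra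
    is the coordinate map of the basis lifting \<open>\<beta>\<close>. It vanishes on \<open>I\<close>, so the map on
    \<open>A[z,x]\<close> vanishes on \<open>J\<close> modulo commutators. Its value at a combination of \<open>z\<^sup>e\<beta>\<close> is the
    vector of coefficients, so a relation has its entries in the commutator ideal
    (\<open>relation_entry_mem_commutator_ideal\<close>).

  \<^item> Conversely, take an ideal that contains all entries of relations of degree \<open>d + 1\<close>. Modulo this ideal
    \<open>z\<close> is injective on \<open>E\<^sub>d\<close>, so that \<open>x\<^sub>i/z\<close> acts on \<open>E\<^sub>d\<close>, say by the matrix \<open>M\<^sub>i\<close>. The \<open>M\<^sub>i\<close> commute
    because \<open>x\<^sub>i x\<^sub>j = x\<^sub>j x\<^sub>i\<close>. Starting from the coordinates of \<open>z\<^sup>d\<close>, the map on \<open>A[z,x]\<close> is in degree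
    \<open>d\<close> the coordinate map of \<open>z\<^sup>d\<beta>\<close>. It therefore vanishes on the generators of \<open>J\<close>, and as it is
    compatible with multiplication, on \<open>J\<close>. Lifting to \<open>J'\<close>
    the relations in \<open>I\<close> that define \<open>T\<^sub>i\<close> then shows that \<open>M\<^sub>i\<close> and \<open>T\<^sub>i\<close> are congruent, so the \<open>T\<^sub>i\<close>
    commute modulo the ideal (\<open>commutator_ideal_subset\<close>).
\<close>

section \<open>Congruences modulo an ideal\<close>

lemma left_ideal_ideal_gen: "left_ideal (ideal_gen U)"
  unfolding ideal_gen_def hull_def left_ideal_def by auto

lemma ideal_gen_superset: "U \<subseteq> ideal_gen U"
  unfolding ideal_gen_def by (rule hull_subset)

lemma ideal_gen_minimal: "U \<subseteq> A \<Longrightarrow> left_ideal A \<Longrightarrow> ideal_gen U \<subseteq> A"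
  unfolding ideal_gen_def by (rule hull_minimal)

locale ring_ideal =
  fixes A :: "'a::comm_ring_1 set"
  assumes left_ideal: "left_ideal A"
begin

definition cong :: "'a \<Rightarrow> 'a \<Rightarrow> bool" (infix \<open>\<approx>\<close> 50) where
  "x \<approx> y \<longleftrightarrow> x - y \<in> A"

lemma zero_mem: "0 \<in> A"
  and add_mem: "x \<in> A \<Longrightarrow> y \<in> A \<Longrightarrow> x + y \<in> A"
  and mult_mem: "x \<in> A \<Longrightarrow> r * x \<in> A"
  using left_ideal unfolding left_ideal_def by auto

lemma uminus_mem: "x \<in> A \<Longrightarrow> - x \<in> A"
  using mult_mem[of x "- 1"] by simp

lemma sum_mem: "(\<And>i. i \<in> U \<Longrightarrow> f i \<in> A) \<Longrightarrow> sum f U \<in> A"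
  by (induction U rule: infinite_finite_induct) (auto intro: zero_mem add_mem)

lemma cong_zero_iff: "x \<approx> 0 \<longleftrightarrow> x \<in> A"
  unfolding cong_def by simp

lemma cong_refl [simp]: "x \<approx> x"
  unfolding cong_def by (simp add: zero_mem)

lemma cong_sym: "x \<approx> y \<Longrightarrow> y \<approx> x"
  unfolding cong_def using uminus_mem[of "x - y"] by simp

lemma cong_trans [trans]: "x \<approx> y \<Longrightarrow> y \<approx> z \<Longrightarrow> x \<approx> z"
  unfolding cong_def using add_mem[of "x - y" "y - z"] by simp

lemma cong_add: "x \<approx> y \<Longrightarrow> x' \<approx> y' \<Longrightarrow> x + x' \<approx> y + y'"
  unfolding cong_def using add_mem[of "x - y" "x' - y'"] by (simp add: algebra_simps)

lemma cong_mult: "x \<approx> y \<Longrightarrow> x' \<approx> y' \<Longrightarrow> x * x' \<approx> y * y'"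
  unfolding cong_def using add_mem[OF mult_mem[of "x - y" x'] mult_mem[of "x' - y'" y]]
  by (simp add: algebra_simps)

lemma cong_diff: "x \<approx> y \<Longrightarrow> x' \<approx> y' \<Longrightarrow> x - x' \<approx> y - y'"
  using cong_add[of x y "- 1 * x'" "- 1 * y'"] cong_mult[of "- 1" "- 1" x' y'] by simp

lemma cong_sum: "(\<And>i. i \<in> U \<Longrightarrow> f i \<approx> g i) \<Longrightarrow> sum f U \<approx> sum g U"
  by (induction U rule: infinite_finite_induct) (auto intro: cong_add)

lemma cong_prod: "(\<And>i. i \<in> U \<Longrightarrow> f i \<approx> g i) \<Longrightarrow> prod f U \<approx> prod g U"
  by (induction U rule: infinite_finite_induct) (auto intro: cong_mult)

lemma det_cong:
  assumes "B \<in> carrier_mat n n" "C \<in> carrier_mat n n"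
    and "\<And>i j. i < n \<Longrightarrow> j < n \<Longrightarrow> B $$ (i, j) \<approx> C $$ (i, j)"
  shows "det B \<approx> det C"
  unfolding det_def'[OF assms(1)] det_def'[OF assms(2)]
  by (intro cong_sum cong_mult cong_prod cong_refl assms(3)) (auto simp: permutes_in_image)

end

section \<open>Determinants over a commutative ring\<close>

text \<open>
  Over a ring with zero divisors there is no rank to argue with. Padding the factors to square
  matrices with zeros leaves the product unchanged and gives the first factor a zero column.
\<close>

lemma det_mult_through_smaller:
  fixes X Y :: "'a::comm_ring_1 mat"
  assumes X: "X \<in> carrier_mat s p" and Y: "Y \<in> carrier_mat p s" and ps: "p < s"
  shows "det (X * Y) = 0"
proof -
  define X' where "X' = mat s s (\<lambda>(i, j). if j < p then X $$ (i, j) else 0)"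
  define Y' where "Y' = mat s s (\<lambda>(i, j). if i < p then Y $$ (i, j) else 0)"
  have c: "X' \<in> carrier_mat s s" "Y' \<in> carrier_mat s s" by (auto simp: X'_def Y'_def)
  have "X * Y = X' * Y'"
  proof (rule eq_matI)
    fix i j assume "i < dim_row (X' * Y')" "j < dim_col (X' * Y')"
    then have ij: "i < s" "j < s" using c by auto
    have "(X * Y) $$ (i, j) = (\<Sum>k\<in>{0..<p}. X $$ (i, k) * Y $$ (k, j))"
      using X Y ij by (simp add: scalar_prod_def)
    also have "\<dots> = (\<Sum>k\<in>{0..<s}. X' $$ (i, k) * Y' $$ (k, j))"
      using ps ij by (intro sum.mono_neutral_cong_left) (auto simp: X'_def Y'_def)
    also have "\<dots> = (X' * Y') $$ (i, j)" using c ij by (simp add: scalar_prod_def)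
    finally show "(X * Y) $$ (i, j) = (X' * Y') $$ (i, j)" .
  qed (use X Y c in auto)
  moreover have "det X' = (\<Sum>i<s. X' $$ (i, p) * cofactor X' i p)"
    by (rule laplace_expansion_column[OF c(1) ps])
  then have "det X' = 0" using ps by (simp add: X'_def)
  ultimately show ?thesis using det_mult[OF c] by simp
qed

lemma det_unit_columns:
  fixes B :: "'a::comm_ring_1 mat"
  assumes "B \<in> carrier_mat (r + n) (r + n)"
    and "\<And>i j. i < r + n \<Longrightarrow> r \<le> j \<Longrightarrow> j < r + n \<Longrightarrow> B $$ (i, j) = (if i = j then 1 else 0)"
  shows "det B = det (mat r r (\<lambda>(i, j). B $$ (i, j)))"
  using assms
proof (induction n arbitrary: B)
  case 0
  then have "mat r r (\<lambda>(i, j). B $$ (i, j)) = B" by (intro eq_matI) auto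
  then show ?case by simp
next
  case (Suc n)
  let ?D = "mat_delete B (r + n) (r + n)"
  have B: "B \<in> carrier_mat (Suc (r + n)) (Suc (r + n))" using Suc.prems(1) by simp
  have D: "?D $$ (i, j) = B $$ (i, j)" if "i < r + n" "j < r + n" for i j
    using mat_delete_index[OF B _ _ that, of "r + n" "r + n"] that by simp
  have "det B = (\<Sum>i<Suc (r + n). B $$ (i, r + n) * cofactor B i (r + n))"
    by (rule laplace_expansion_column[OF B]) simp
  also have "\<dots> = (\<Sum>i<Suc (r + n). if i = r + n then cofactor B i (r + n) else 0)"
    by (rule sum.cong) (auto simp: Suc.prems(2))
  also have "\<dots> = det ?D" by (simp add: cofactor_def)
  also have "\<dots> = det (mat r r (\<lambda>(i, j). ?D $$ (i, j)))"
    using mat_delete_carrier[OF B, of "r + n" "r + n"] by (intro Suc.IH) (auto simp: D Suc.prems(2))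
  also have "mat r r (\<lambda>(i, j). ?D $$ (i, j)) = mat r r (\<lambda>(i, j). B $$ (i, j))"
    by (intro eq_matI) (auto simp: D)
  finally show ?case .
qed

lemma strict_mono_insert_index: "strict_mono (insert_index i)"
  by (rule strict_monoI) (auto simp: insert_index_def)

text \<open>
  Repeated Laplace expansion along the bad rows \<open>BR\<close> and the bad columns \<open>BC\<close> leaves only minors that
  avoid them. Expansion along a bad row may also delete good columns, but the bound on the
  cardinalities guarantees that at least \<open>r\<close> good rows and columns survive until the bad ones are gone;
  any larger minors are then expanded further, down to size \<open>r\<close>. The index maps are increasing because
  deleting rows and columns keeps the order, and the minors of a Fitting ideal are listed in this form.
\<close>

lemma (in ring_ideal) det_mem_of_minors:
  assumes "B \<in> carrier_mat s s" "BR \<subseteq> {..<s}" "BC \<subseteq> {..<s}" "card BR + card BC + r \<le> s"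
    and "\<And>f g. strict_mono_on {..<r} f \<Longrightarrow> strict_mono_on {..<r} g \<Longrightarrow>
           f ` {..<r} \<subseteq> {..<s} - BR \<Longrightarrow> g ` {..<r} \<subseteq> {..<s} - BC \<Longrightarrow>
           det (mat r r (\<lambda>(i, j). B $$ (f i, g j))) \<in> A"
  shows "det B \<in> A"
  using assms
proof (induction s arbitrary: B BR BC)
  case 0
  have "mat r r (\<lambda>(i, j). B $$ (i, j)) = B" using 0 by (intro eq_matI) auto
  then show ?case using "0.prems"(5)[of id id] 0 by (auto simp: strict_mono_on_def)
next
  case (Suc s)
  have fin: "finite BR" "finite BC" using Suc.prems(2,3) finite_subset by auto
  show ?case
  proof (cases "r = Suc s")
    case True
    then have "BR = {}" "BC = {}" using Suc.prems(4) fin by auto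
    moreover have "mat r r (\<lambda>(i, j). B $$ (i, j)) = B" using Suc.prems True by (intro eq_matI) auto
    ultimately show ?thesis using Suc.prems(5)[of id id] True by (auto simp: strict_mono_on_def)
  next
    case False
    have del: "cofactor B i j \<in> A"
      if ij: "i < Suc s" "j < Suc s" and c: "card (BR - {i}) + card (BC - {j}) + r \<le> s" for i j
    proof -
      let ?D = "mat_delete B i j"
      let ?pre = "\<lambda>i X. insert_index i -` X \<inter> {..<s}"
      have card: "card (?pre i X) \<le> card (X - {i})" if "finite X" for i X
      proof (rule card_inj_on_le[where f = "insert_index i"])
        show "inj_on (insert_index i) (?pre i X)"
          using strict_mono_insert_index strict_mono_imp_inj_on inj_on_subset by blast
      qed (use that in \<open>auto simp: insert_index_def\<close>)
      have "det ?D \<in> A"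
      proof (rule Suc.IH[of ?D "?pre i BR" "?pre j BC"])
        show "?D \<in> carrier_mat s s" using mat_delete_carrier[OF Suc.prems(1), of i j] by simp
        show "card (?pre i BR) + card (?pre j BC) + r \<le> s" using card fin c add_mono
          by (meson add_le_mono le_trans order_refl)
        fix f g assume f: "strict_mono_on {..<r} f" "f ` {..<r} \<subseteq> {..<s} - ?pre i BR"
          and g: "strict_mono_on {..<r} g" "g ` {..<r} \<subseteq> {..<s} - ?pre j BC"
        have m: "strict_mono_on {..<r} (\<lambda>k. insert_index i (f k))" if "strict_mono_on {..<r} f" for i f
          using that strict_mono_insert_index[of i] by (auto simp: strict_mono_on_def strict_mono_def)
        have sub: "(\<lambda>k. insert_index i (f k)) ` {..<r} \<subseteq> {..<Suc s} - X"
          if "f ` {..<r} \<subseteq> {..<s} - ?pre i X" for i f X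
        proof
          fix y assume "y \<in> (\<lambda>k. insert_index i (f k)) ` {..<r}"
          then obtain k where k: "k < r" "y = insert_index i (f k)" by auto
          have "f k < s" "insert_index i (f k) \<notin> X" using that k(1) by auto
          then show "y \<in> {..<Suc s} - X" using k(2) by (auto simp: insert_index_def split: if_splits)
        qed
        have "mat r r (\<lambda>(k, l). ?D $$ (f k, g l))
            = mat r r (\<lambda>(k, l). B $$ (insert_index i (f k), insert_index j (g l)))"
          using f(2) g(2) by (intro eq_matI) (auto intro!: mat_delete_index[symmetric, OF Suc.prems(1) ij])
        then show "det (mat r r (\<lambda>(k, l). ?D $$ (f k, g l))) \<in> A"
          using Suc.prems(5)[OF m[OF f(1)] m[OF g(1)] sub[OF f(2)] sub[OF g(2)]] by simp
      qed auto
      then show ?thesis by (simp add: cofactor_def mult_mem)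
    qed
    show ?thesis
    proof (cases "BC = {}")
      case True
      define i where "i = (if BR = {} then 0 else SOME i. i \<in> BR)"
      have "i \<in> BR" if "BR \<noteq> {}" using that someI_ex[of "\<lambda>i. i \<in> BR"] by (auto simp: i_def)
      then have i: "i < Suc s" "card (BR - {i}) + r \<le> s"
        using Suc.prems(2,4) False True fin card_Diff_singleton[of i BR] card_gt_0_iff[of BR]
        by (cases "BR = {}"; auto simp: i_def)+
      have "det B = (\<Sum>j<Suc s. B $$ (i, j) * cofactor B i j)"
        by (rule laplace_expansion_row[OF Suc.prems(1) i(1)])
      also have "\<dots> \<in> A" using i True by (intro sum_mem mult_mem del) auto
      finally show ?thesis .
    next
      case nonempty: False
      then obtain j where j: "j \<in> BC" by auto
      then have j': "j < Suc s" using Suc.prems(3) by auto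
      have "card BC > 0" using nonempty fin by (simp add: card_gt_0_iff)
      then have c: "card (BR - {i}) + card (BC - {j}) + r \<le> s" for i
        using Suc.prems(4) card_Diff_singleton[OF j] card_mono[OF fin(1), of "BR - {i}"] by auto
      have "det B = (\<Sum>i<Suc s. B $$ (i, j) * cofactor B i j)"
        by (rule laplace_expansion_column[OF Suc.prems(1) j'])
      also have "\<dots> \<in> A" using j' c by (intro sum_mem mult_mem del) auto
      finally show ?thesis .
    qed
  qed
qed

section \<open>Fitting ideals\<close>

lemma pick_image_strict_mono:
  assumes "strict_mono_on {..<r} g" "b < r"
  shows "pick (g ` {..<r}) b = g b"
  using assms(2)
proof (induction b)
  case 0
  have "g 0 \<le> g k" if "k < r" for k
    using assms(1) that 0 by (cases k) (auto simp: strict_mono_on_def intro: less_imp_le)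
  then show ?case using 0 by (auto intro!: Least_equality)
next
  case (Suc b)
  have le: "g (Suc b) \<le> g k" if "k < r" "g b < g k" for k
  proof -
    have "\<not> k \<le> b"
      using that Suc.prems assms(1) by (metis Suc_lessD lessThan_iff linorder_not_less order_le_less strict_mono_onD)
    then show ?thesis
      using that Suc.prems assms(1)
      by (metis Suc_leI lessThan_iff linorder_not_less nat_less_le order_refl strict_mono_onD less_imp_le)
  qed
  have "g b < g (Suc b)" using assms(1) Suc.prems by (auto simp: strict_mono_on_def)
  then show ?case using Suc le by (auto intro!: Least_equality)
qed

lemma submatrix_rows:
  assumes "length rs = r" "C \<subseteq> {..<n}" "card C = r"
  shows "submatrix (mat_of_rows n rs) UNIV C = mat r r (\<lambda>(a, b). (rs ! a) $ pick C b)"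
proof -
  have "{j. j < n \<and> j \<in> C} = C" using assms(2) by auto
  moreover have "finite C" using assms(2) finite_subset by auto
  moreover have "pick C b < n" if "b < card C" for b using pick_in_set_le[OF that] assms(2) by auto
  ultimately show ?thesis
    using assms unfolding submatrix_def
    by (intro eq_matI) (auto simp: pick_UNIV mat_of_rows_def)
qed

lemma relation_minorsI:
  assumes "\<And>i. i < r \<Longrightarrow> \<rho> i \<in> relations s S gs"
    and "strict_mono_on {..<r} g" "g ` {..<r} \<subseteq> {..<length gs}"
  shows "det (mat r r (\<lambda>(i, j). \<rho> i $ g j)) \<in> relation_minors s S gs r"
proof -
  let ?rs = "map \<rho> [0..<r]" and ?C = "g ` {..<r}"
  have card: "card ?C = r" using assms(2) by (simp add: card_image strict_mono_on_imp_inj_on)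
  have "submatrix (mat_of_rows (length gs) ?rs) UNIV ?C = mat r r (\<lambda>(i, j). \<rho> i $ g j)"
    using assms card
    by (subst submatrix_rows[where r = r])
       (auto intro!: eq_matI simp: pick_image_strict_mono)
  moreover have "set ?rs \<subseteq> relations s S gs" using assms(1) by auto
  ultimately show ?thesis using assms(3) card unfolding relation_minors_def
    by (smt (verit) length_map length_upt mem_Collect_eq minus_nat.diff_0)
qed

lemma relation_minorsE:
  assumes "x \<in> relation_minors s S gs r"
  obtains \<rho> g where "\<And>i. i < r \<Longrightarrow> \<rho> i \<in> relations s S gs"
    and "\<And>j. j < r \<Longrightarrow> g j < length gs"
    and "x = det (mat r r (\<lambda>(i, j). \<rho> i $ g j))"
proof -
  obtain rs C where rs: "set rs \<subseteq> relations s S gs" "length rs = r" "C \<subseteq> {..<length gs}" "card C = r"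
    "x = det (submatrix (mat_of_rows (length gs) rs) UNIV C)"
    using assms unfolding relation_minors_def by auto
  show ?thesis
  proof (rule that[of "\<lambda>i. rs ! i" "pick C"])
    show "pick C j < length gs" if "j < r" for j using pick_in_set_le[of j C] rs that by auto
  qed (use rs submatrix_rows[OF rs(2,3,4)] in auto)
qed

text \<open>
  The plain name \<open>module\<close> would denote modules over a ring with explicit carrier.
\<close>

context Modules.module
begin

lemma combination_trans:
  fixes N p :: nat
  assumes S: "subspace S" and g: "\<And>i. i < p \<Longrightarrow> g i - (\<Sum>j<N. P i j *s b j) \<in> S"
  shows "(\<Sum>i<p. c i *s g i) - (\<Sum>j<N. (\<Sum>i<p. c i * P i j) *s b j) \<in> S"
proof -
  have "(\<Sum>i<p. c i *s (g i - (\<Sum>j<N. P i j *s b j))) \<in> S"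
    using S g by (intro subspace_sum subspace_scale) auto
  also have "(\<Sum>i<p. c i *s (g i - (\<Sum>j<N. P i j *s b j)))
      = (\<Sum>i<p. c i *s g i) - (\<Sum>i<p. \<Sum>j<N. (c i * P i j) *s b j)"
    by (simp add: scale_right_diff_distrib sum_subtractf scale_sum_right)
  also have "(\<Sum>i<p. \<Sum>j<N. (c i * P i j) *s b j) = (\<Sum>j<N. (\<Sum>i<p. c i * P i j) *s b j)"
    by (subst sum.swap) (simp add: scale_sum_left)
  finally show ?thesis .
qed

lemma relations_vec_iff:
  "vec (length gs) f \<in> relations scale S gs \<longleftrightarrow> (\<Sum>i<length gs. f i *s (gs ! i)) \<in> S"
  by (simp add: relations_def lincomb_def)

lemma relations_iff:
  "c \<in> relations scale S gs \<longleftrightarrow>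
     c \<in> carrier_vec (length gs) \<and> (\<Sum>i<length gs. c $ i *s (gs ! i)) \<in> S"
  by (simp add: relations_def lincomb_def)

text \<open>
  Let \<open>p\<close> be the length of \<open>gs\<close> and \<open>N\<close> that of \<open>bs\<close>, so that \<open>r = p + 1 - N\<close> when this is positive.
  Let \<open>P\<close> express \<open>gs\<close> in \<open>bs\<close> and let \<open>Q\<close> express \<open>bs\<close> in \<open>gs\<close>. The rows of \<open>Q P - 1\<close> are relations of \<open>bs\<close>, and
  the rows of \<open>1 - P Q\<close> are relations of \<open>gs\<close>; a relation \<open>c\<close> of \<open>gs\<close> gives the relation \<open>c P\<close> of \<open>bs\<close>, and a
  relation \<open>c\<close> of \<open>bs\<close> gives the relation \<open>c Q\<close> of \<open>gs\<close>. Both inclusions come from a determinant of a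
  product that is computed in two ways.
  
  For a minor of \<open>gs\<close>, with rows \<open>C\<close> and columns selected by a matrix \<open>D\<close>, stack \<open>C\<close> on \<open>Q\<close> and place \<open>D\<close>
  beside \<open>P\<close>. The product has size \<open>r + N > p\<close> and factors through size \<open>p\<close>, so its determinant is zero. Its
  blocks are \<open>C D\<close>, \<open>C P\<close>, \<open>Q D\<close> and \<open>Q P\<close>. Modulo the entries of relations of \<open>bs\<close>, the block \<open>C P\<close> is zero and
  \<open>Q P\<close> is the identity, so the determinant is the minor \<open>det (C D)\<close>.
  
  For an entry \<open>c\<^sub>l\<close> of a relation of \<open>bs\<close>, let \<open>F\<close> be the matrix of size \<open>p + 1\<close> with rows \<open>(1, -P\<^sub>l)\<close> and
  \<open>(0, c\<^sub>l)\<close>, where \<open>P\<^sub>l\<close> is the \<open>l\<close>'th column of \<open>P\<close>. With \<open>L\<close> the matrix \<open>P\<close> stacked on \<open>-c\<close>, and \<open>R = (Q, -e\<^sub>l)\<close>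
  where \<open>e\<^sub>l\<close> is the \<open>l\<close>'th unit column, the matrix \<open>F - L R\<close> consists of relations of \<open>gs\<close> and a zero column. The block matrix with rows \<open>(F - L R, -L)\<close>
  and \<open>(R, 1)\<close> is the product of the block triangular matrices with rows \<open>(1, -L)\<close>, \<open>(0, 1)\<close> and \<open>(F, 0)\<close>,
  \<open>(R, 1)\<close>, so its determinant is \<open>det F = c\<^sub>l\<close>. Expansion along the \<open>N\<close> rows and \<open>N\<close> columns outside of
  \<open>F - L R\<close> writes it in terms of minors of relations of \<open>gs\<close> of size \<open>r\<close>.
\<close>

lemma fitting_minors_change:
  assumes S: "subspace S" and gs: "generates scale M S gs" and bs: "generates scale M S bs"
  defines "r \<equiv> nat (int (length gs) - (int (length bs) - 1))"
  shows "ideal_gen (relation_minors scale S gs r)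
       = ideal_gen {c $ j | c j. c \<in> relations scale S bs \<and> j < length bs}"
proof -
  define p where "p = length gs"
  define N where "N = length bs"
  define A where "A = ideal_gen {c $ j | c j. c \<in> relations scale S bs \<and> j < length bs}"
  define B where "B = ideal_gen (relation_minors scale S gs r)"
  interpret A: ring_ideal A by unfold_locales (simp add: A_def left_ideal_ideal_gen)
  interpret B: ring_ideal B by unfold_locales (simp add: B_def left_ideal_ideal_gen)
  note relA = relations_vec_iff[of bs _ S, folded N_def]
  note relB = relations_vec_iff[of gs _ S, folded p_def]
  have A: "f j \<in> A" if "(\<Sum>j<N. f j *s (bs ! j)) \<in> S" "j < N" for f j
  proof -
    have "vec N f \<in> relations scale S bs" using that relA by auto
    then have "vec N f $ j \<in> {c $ j | c j. c \<in> relations scale S bs \<and> j < length bs}"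
      using that(2) unfolding N_def by blast
    then show ?thesis using that(2) ideal_gen_superset unfolding A_def by fastforce
  qed
  have "\<exists>f. gs ! i - (\<Sum>j<N. f j *s (bs ! j)) \<in> S" if "i < p" for i
    using bs gs that unfolding generates_def lincomb_def p_def N_def by (meson nth_mem subsetD)
  then obtain P where P: "\<And>i. i < p \<Longrightarrow> gs ! i - (\<Sum>j<N. P i j *s (bs ! j)) \<in> S" by metis
  have "\<exists>f. bs ! j - (\<Sum>i<p. f i *s (gs ! i)) \<in> S" if "j < N" for j
    using bs gs that unfolding generates_def lincomb_def p_def N_def by (meson nth_mem subsetD)
  then obtain Q where Q: "\<And>j. j < N \<Longrightarrow> bs ! j - (\<Sum>i<p. Q j i *s (gs ! i)) \<in> S" by metis
  have gs_to_bs: "(\<Sum>j<N. (\<Sum>i<p. c i * P i j) *s (bs ! j)) \<in> S" if "(\<Sum>i<p. c i *s (gs ! i)) \<in> S" for c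
    using subspace_diff[OF S that combination_trans[OF S, of p "\<lambda>i. gs ! i" P "\<lambda>j. bs ! j" N c, OF P]] by simp
  have bs_to_gs: "(\<Sum>i<p. (\<Sum>j<N. c j * Q j i) *s (gs ! i)) \<in> S" if "(\<Sum>j<N. c j *s (bs ! j)) \<in> S" for c
    using subspace_diff[OF S that combination_trans[OF S, of N "\<lambda>j. bs ! j" Q "\<lambda>i. gs ! i" p c, OF Q]] by simp
  have unit: "(\<Sum>i<n. (if i = k then 1 else 0) *s f i) = f k" if "k < n" for n k and f :: "nat \<Rightarrow> 'b"
    using that by (simp add: if_distrib[of "\<lambda>c. c *s _"] sum.delta cong: if_cong)
  have QP: "A.cong (\<Sum>i<p. Q j i * P i k) (if k = j then 1 else 0)" if jk: "j < N" "k < N" for j k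
  proof -
    have "(\<Sum>k<N. ((if k = j then 1 else 0) - (\<Sum>i<p. Q j i * P i k)) *s (bs ! k))
        = bs ! j - (\<Sum>k<N. (\<Sum>i<p. Q j i * P i k) *s (bs ! k))"
      by (simp only: scale_left_diff_distrib sum_subtractf unit[OF jk(1)])
    also have "\<dots> = (bs ! j - (\<Sum>i<p. Q j i *s (gs ! i)))
        + ((\<Sum>i<p. Q j i *s (gs ! i)) - (\<Sum>k<N. (\<Sum>i<p. Q j i * P i k) *s (bs ! k)))" by simp
    also have "\<dots> \<in> S" by (intro subspace_add S Q jk combination_trans P)
    finally have "A.cong (if k = j then 1 else 0) (\<Sum>i<p. Q j i * P i k)"
      using A[OF _ jk(2)] unfolding A.cong_def by fast
    then show ?thesis by (rule A.cong_sym)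
  qed
  have PQ: "(\<Sum>k<p. ((if k = i then 1 else 0) - (\<Sum>j<N. P i j * Q j k)) *s (gs ! k)) \<in> S" if i: "i < p" for i
  proof -
    have "(\<Sum>k<p. ((if k = i then 1 else 0) - (\<Sum>j<N. P i j * Q j k)) *s (gs ! k))
        = gs ! i - (\<Sum>k<p. (\<Sum>j<N. P i j * Q j k) *s (gs ! k))"
      by (simp only: scale_left_diff_distrib sum_subtractf unit[OF i])
    also have "\<dots> = (gs ! i - (\<Sum>j<N. P i j *s (bs ! j)))
        + ((\<Sum>j<N. P i j *s (bs ! j)) - (\<Sum>k<p. (\<Sum>j<N. P i j * Q j k) *s (gs ! k)))" by simp
    also have "\<dots> \<in> S" by (intro subspace_add S P i combination_trans Q)
    finally show ?thesis .
  qed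
  have r: "r + N \<ge> Suc p" "r = 0 \<or> r + N = Suc p" unfolding r_def p_def N_def by auto
  have "relation_minors scale S gs r \<subseteq> A"
  proof
    fix x assume "x \<in> relation_minors scale S gs r"
    then obtain \<rho> g where \<rho>: "\<And>a. a < r \<Longrightarrow> \<rho> a \<in> relations scale S gs"
      and g: "\<And>j. j < r \<Longrightarrow> g j < p" and x: "x = det (mat r r (\<lambda>(i, j). \<rho> i $ g j))"
      unfolding p_def by (elim relation_minorsE) blast
    \<comment> \<open>The factors are \<open>U\<close>, which is \<open>C\<close> on top of \<open>Q\<close>, and \<open>V = (D, P)\<close>; replacing the right-hand
      blocks of their product by their residues gives \<open>W\<close>.\<close>
    define U where "U = mat (r + N) p (\<lambda>(a, i). if a < r then \<rho> a $ i else Q (a - r) i)"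
    define V where "V = mat p (r + N) (\<lambda>(i, b). if b < r then if i = g b then 1 else 0 else P i (b - r))"
    define W where "W = mat (r + N) (r + N) (\<lambda>(a, b). if b < r then (U * V) $$ (a, b) else if a = b then 1 else 0)"
    have UV: "(U * V) $$ (a, b) = (\<Sum>i<p. U $$ (a, i) * V $$ (i, b))" if "a < r + N" "b < r + N" for a b
      using that by (simp add: U_def V_def scalar_prod_def atLeast0LessThan)
    have left: "(U * V) $$ (a, b) = \<rho> a $ g b" if ab: "a < r" "b < r" for a b
    proof -
      have "(U * V) $$ (a, b) = (\<Sum>i<p. if i = g b then \<rho> a $ i else 0)"
        unfolding UV[OF trans_less_add1[OF ab(1)] trans_less_add1[OF ab(2)]]
        using ab by (intro sum.cong) (auto simp: U_def V_def)
      also have "\<dots> = \<rho> a $ g b" using g[OF ab(2)] by simp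
      finally show ?thesis .
    qed
    have right: "A.cong ((U * V) $$ (a, b)) (if a = b then 1 else 0)" if "a < r + N" "r \<le> b" "b < r + N" for a b
    proof (cases "a < r")
      case True
      have "(U * V) $$ (a, b) = (\<Sum>i<p. \<rho> a $ i * P i (b - r))"
        unfolding UV[OF that(1,3)] using that True by (intro sum.cong) (auto simp: U_def V_def)
      also have "\<dots> \<in> A"
        using \<rho>[OF True] that by (intro A[OF gs_to_bs]) (auto simp: relations_iff p_def)
      finally show ?thesis using that True by (simp add: A.cong_zero_iff)
    next
      case False
      have "(U * V) $$ (a, b) = (\<Sum>i<p. Q (a - r) i * P i (b - r))"
        unfolding UV[OF that(1,3)] using that False by (intro sum.cong) (auto simp: U_def V_def)
      moreover have "(b - r = a - r) = (a = b)" using False that by auto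
      ultimately show ?thesis using QP[of "a - r" "b - r"] that False by simp
    qed
    have "0 = det (U * V)"
      using r(1) by (intro det_mult_through_smaller[symmetric]) (auto simp: U_def V_def)
    also have "A.cong \<dots> (det W)"
      by (rule A.det_cong[of _ "r + N"]) (auto simp: W_def right, auto simp: U_def V_def)
    also have "det W = det (mat r r (\<lambda>(a, b). W $$ (a, b)))"
      by (rule det_unit_columns[where n = N]) (auto simp: W_def)
    also have "mat r r (\<lambda>(a, b). W $$ (a, b)) = mat r r (\<lambda>(a, b). \<rho> a $ g b)"
      by (intro eq_matI) (auto simp: W_def left)
    finally show "x \<in> A" using A.cong_sym A.cong_zero_iff x by blast
  qed
  moreover have "c $ l \<in> B" if c: "c \<in> relations scale S bs" and l: "l < N" for c l
  proof (cases "r = 0")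
    case True
    have "1 \<in> relation_minors scale S gs 0"
      using relation_minorsI[of 0 _ "scale" S gs id] by (simp add: strict_mono_on_def)
    then have "1 \<in> B" using ideal_gen_superset True unfolding B_def by blast
    then show ?thesis using B.mult_mem[of 1 "c $ l"] by simp
  next
    case False
    define s where "s = Suc p + N"
    define L where "L i k = (if i < p then P i k else - (c $ k))" for i k
    define R where "R k j = (if j < p then Q k j else if k = l then - 1 else 0)" for k j
    define \<rho> where "\<rho> i = vec p (\<lambda>j. (if i = j then 1 else 0) - (\<Sum>k<N. L i k * R k j))" for i
    \<comment> \<open>The block triangular factors with rows \<open>(1, -L)\<close>, \<open>(0, 1)\<close> and \<open>(F, 0)\<close>, \<open>(R, 1)\<close>.\<close>
    define U where "U = mat s s (\<lambda>(i, j). if j \<le> p then if i = j then 1 else 0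
        else if i \<le> p then - L i (j - Suc p) else if i = j then 1 else (0::'a))"
    define F where "F i j = (if i < p then if j < p then if i = j then 1 else 0 else - P i l
        else if j = p then c $ l else 0)" for i j
    define V where "V = mat s s (\<lambda>(i, j). if j \<le> p then if i \<le> p then F i j else R (i - Suc p) j
        else if i = j then 1 else 0)"
    have carr: "U \<in> carrier_mat s s" "V \<in> carrier_mat s s" by (auto simp: U_def V_def)
    have rel: "\<rho> i \<in> relations scale S gs" if "i \<le> p" for i
    proof (cases "i < p")
      case True
      have eq: "(if i = j then 1 else 0) - (\<Sum>k<N. L i k * R k j)
          = (if j = i then 1 else 0) - (\<Sum>k<N. P i k * Q k j)" if "j < p" for j
        using True that by (auto simp: L_def R_def)
      show ?thesis unfolding \<rho>_def relB
        using PQ[OF True] by (subst sum.cong[OF refl arg_cong[where f = "\<lambda>x. x *s _"], OF eq]) auto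
    next
      case nlt: False
      then have eq: "(if i = j then 1 else 0) - (\<Sum>k<N. L i k * R k j) = (\<Sum>k<N. c $ k * Q k j)" if "j < p" for j
        using that \<open>i \<le> p\<close> by (simp add: L_def R_def sum_negf)
      show ?thesis unfolding \<rho>_def relB
        using bs_to_gs[of "\<lambda>k. c $ k"] c
        by (subst sum.cong[OF refl arg_cong[where f = "\<lambda>x. x *s _"], OF eq]) (auto simp: relations_iff N_def)
    qed
    have detU: "det U = 1"
    proof -
      have "det U = prod_list (diag_mat U)"
        by (rule det_upper_triangular[OF _ carr(1)]) (auto simp: U_def upper_triangular_def)
      also have "diag_mat U = map (\<lambda>_. 1) [0..<s]" by (auto simp: diag_mat_def U_def)
      also have "prod_list \<dots> = 1" by (induction s) auto
      finally show ?thesis .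
    qed
    have detV: "det V = c $ l"
    proof -
      have "det V = det (mat (Suc p) (Suc p) (\<lambda>(i, j). V $$ (i, j)))"
        by (rule det_unit_columns[where n = N]) (auto simp: V_def s_def)
      also have "mat (Suc p) (Suc p) (\<lambda>(i, j). V $$ (i, j)) = mat (Suc p) (Suc p) (\<lambda>(i, j). F i j)"
        by (intro eq_matI) (auto simp: V_def s_def)
      also have "det \<dots> = prod_list (diag_mat (mat (Suc p) (Suc p) (\<lambda>(i, j). F i j)))"
        by (rule det_upper_triangular[where n = "Suc p"]) (auto simp: F_def upper_triangular_def)
      also have "diag_mat (mat (Suc p) (Suc p) (\<lambda>(i, j). F i j)) = map (\<lambda>_. 1) [0..<p] @ [c $ l]"
        by (auto simp: diag_mat_def F_def)
      also have "prod_list \<dots> = c $ l" by (induction p) auto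
      finally show ?thesis .
    qed
    have split: "(\<Sum>k<m + n. f k) = (\<Sum>k<m. f k) + (\<Sum>k<n. f (m + k))" for f :: "nat \<Rightarrow> 'a" and m n
      by (induction n) (simp_all add: add.assoc)
    have UV: "(U * V) $$ (i, j) = F i j - (\<Sum>k<N. L i k * R k j)" if ij: "i \<le> p" "j \<le> p" for i j
    proof -
      have "(U * V) $$ (i, j) = (\<Sum>k<Suc p + N. U $$ (i, k) * V $$ (k, j))"
        using ij by (simp add: U_def V_def scalar_prod_def atLeast0LessThan s_def)
      also have "\<dots> = (\<Sum>k<Suc p. U $$ (i, k) * V $$ (k, j)) + (\<Sum>k<N. U $$ (i, Suc p + k) * V $$ (Suc p + k, j))"
        by (rule split)
      also have "(\<Sum>k<Suc p. U $$ (i, k) * V $$ (k, j)) = (\<Sum>k<Suc p. if k = i then F k j else 0)"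
        using ij by (intro sum.cong) (auto simp: U_def V_def s_def)
      also have "\<dots> = F i j" using ij by (simp del: sum.lessThan_Suc)
      also have "(\<Sum>k<N. U $$ (i, Suc p + k) * V $$ (Suc p + k, j)) = (\<Sum>k<N. - (L i k * R k j))"
        using ij by (intro sum.cong) (auto simp: U_def V_def s_def)
      finally show ?thesis by (simp add: sum_negf)
    qed
    have good: "(U * V) $$ (i, j) = \<rho> i $ j" if "i \<le> p" "j < p" for i j
      unfolding UV[OF that(1) less_imp_le[OF that(2)]] using that by (auto simp: \<rho>_def F_def)
    have zero: "(U * V) $$ (i, p) = 0" if "i \<le> p" for i
    proof -
      have "(\<Sum>k<N. L i k * R k p) = (\<Sum>k<N. if k = l then - L i k else 0)"
        by (intro sum.cong) (auto simp: R_def)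
      also have "\<dots> = - L i l" using l by simp
      finally show ?thesis using that unfolding UV[OF that order_refl] by (auto simp: F_def L_def)
    qed
    \<comment> \<open>A minor that uses the zero column vanishes; all others are minors of relations.\<close>
    have "det (U * V) \<in> B"
    proof (rule B.det_mem_of_minors[where BR = "{Suc p..<s}" and BC = "{Suc p..<s}" and s = s and r = r])
      fix f g assume f: "f ` {..<r} \<subseteq> {..<s} - {Suc p..<s}"
        and g: "strict_mono_on {..<r} g" "g ` {..<r} \<subseteq> {..<s} - {Suc p..<s}"
      have fp: "f i \<le> p" "g i \<le> p" if "i < r" for i using f g(2) that by force+
      let ?m = "mat r r (\<lambda>(i, j). (U * V) $$ (f i, g j))"
      show "det ?m \<in> B"
      proof (cases "\<exists>b<r. g b = p")
        case True
        then obtain b where b: "b < r" "g b = p" by blast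
        have "det ?m = (\<Sum>i<r. ?m $$ (i, b) * cofactor ?m i b)"
          by (rule laplace_expansion_column[OF _ b(1)]) simp
        also have "\<dots> = 0" using b fp by (intro sum.neutral) (auto simp: zero)
        finally show ?thesis using B.zero_mem by simp
      next
        case False
        then have gp: "g i < p" if "i < r" for i using fp(2)[OF that] that by (metis order_le_less)
        have "?m = mat r r (\<lambda>(i, j). \<rho> (f i) $ g j)"
          using fp gp by (intro eq_matI) (auto simp: good)
        also have "det \<dots> \<in> relation_minors scale S gs r"
          using fp gp rel g(1) by (intro relation_minorsI) (auto simp: p_def)
        finally show ?thesis using ideal_gen_superset unfolding B_def by blast
      qed
    qed (use carr r False in \<open>auto simp: s_def\<close>)
    then show ?thesis using det_mult[OF carr] detU detV by simp
  qed
  ultimately have minors: "relation_minors scale S gs r \<subseteq> A"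
    and entries: "{c $ j | c j. c \<in> relations scale S bs \<and> j < length bs} \<subseteq> B"
    unfolding N_def by auto
  show ?thesis
    using ideal_gen_minimal[OF minors A.left_ideal] ideal_gen_minimal[OF entries B.left_ideal]
    unfolding A_def B_def by (rule equalityI)
qed

theorem fitting_ideal_pred_generators:
  assumes "subspace S" and "generates scale M S bs"
  shows "fitting_ideal scale M S (int (length bs) - 1)
       = ideal_gen {c $ j | c j. c \<in> relations scale S bs \<and> j < length bs}"
proof -
  have "generates scale M S (SOME gs. generates scale M S gs)"
    by (rule someI[of "generates scale M S", OF assms(2)])
  from fitting_minors_change[OF assms(1) this assms(2)] show ?thesis
    unfolding fitting_ideal_def Let_def .
qed

end

section \<open>Coordinates in a basis of a quotient\<close>

context Modules.module
begin

lemma basis_coordinates_unique: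
  assumes "is_basis scale M S bs" and "(\<Sum>i<length bs. c i *s (bs ! i)) \<in> S" and "l < length bs"
  shows "c l = 0"
proof -
  have "vec (length bs) c \<in> relations scale S bs" using assms(2) by (simp add: relations_vec_iff)
  then have "vec (length bs) c = 0\<^sub>v (length bs)" using assms(1) by (simp add: is_basis_def)
  then show ?thesis using assms(3) by (metis index_vec index_zero_vec(1))
qed

lemma generatesD:
  assumes "generates scale M S gs" "x \<in> M"
  obtains c where "x - (\<Sum>i<length gs. c i *s (gs ! i)) \<in> S"
  using assms unfolding generates_def lincomb_def by blast

lemma matrix_in_basis:
  assumes S: "subspace S" and b: "is_basis scale M S bs"
    and \<phi>: "\<And>j. j < length bs \<Longrightarrow> \<phi> (bs ! j) \<in> M"
  shows "matrix_in_basis scale S bs \<phi> \<in> carrier_mat (length bs) (length bs)"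
    and "j < length bs \<Longrightarrow>
      \<phi> (bs ! j) - (\<Sum>l<length bs. (matrix_in_basis scale S bs \<phi> $$ (l, j)) *s (bs ! l)) \<in> S"
proof -
  define n where "n = length bs"
  let ?P = "\<lambda>T. T \<in> carrier_mat n n \<and> (\<forall>j<n. \<phi> (bs ! j) - lincomb scale bs (col T j) \<in> S)"
  have lc: "lincomb scale bs (col T j) = (\<Sum>l<n. (T $$ (l, j)) *s (bs ! l))"
    if "T \<in> carrier_mat n n" "j < n" for T j
    using that unfolding lincomb_def n_def by (intro sum.cong) auto
  have "\<exists>c. \<phi> (bs ! j) - (\<Sum>l<n. c l *s (bs ! l)) \<in> S" if "j < n" for j
    using b \<phi>[of j] that unfolding is_basis_def n_def by (metis generatesD)
  then obtain P where P: "\<And>j. j < n \<Longrightarrow> \<phi> (bs ! j) - (\<Sum>l<n. P j l *s (bs ! l)) \<in> S" by metis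
  have "\<exists>!T. ?P T"
  proof (rule ex1I)
    have "lincomb scale bs (col (mat n n (\<lambda>(l, j). P j l)) j) = (\<Sum>l<n. P j l *s (bs ! l))"
      if "j < n" for j
      using that by (subst lc) auto
    then show "?P (mat n n (\<lambda>(l, j). P j l))" using P by (auto simp del: col_mat)
    fix T assume T: "?P T"
    show "T = mat n n (\<lambda>(l, j). P j l)"
    proof (rule eq_matI)
      fix l j assume "l < dim_row (mat n n (\<lambda>(l, j). P j l))" "j < dim_col (mat n n (\<lambda>(l, j). P j l))"
      then have lj: "l < n" "j < n" by auto
      have "(\<Sum>l<n. (T $$ (l, j) - P j l) *s (bs ! l))
          = (\<phi> (bs ! j) - (\<Sum>l<n. P j l *s (bs ! l))) - (\<phi> (bs ! j) - lincomb scale bs (col T j))"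
        using T lj by (simp add: lc scale_left_diff_distrib sum_subtractf)
      also have "\<dots> \<in> S" using subspace_diff[OF S P[OF lj(2)]] T lj by blast
      finally have "T $$ (l, j) - P j l = 0"
        using lj(1) unfolding n_def by (rule basis_coordinates_unique[OF b])
      then show "T $$ (l, j) = mat n n (\<lambda>(l, j). P j l) $$ (l, j)" using lj by simp
    qed (use T in auto)
  qed
  from theI'[OF this] have P: "?P (matrix_in_basis scale S bs \<phi>)"
    unfolding matrix_in_basis_def n_def .
  then show "matrix_in_basis scale S bs \<phi> \<in> carrier_mat (length bs) (length bs)"
    by (simp add: n_def)
  show "\<phi> (bs ! j) - (\<Sum>l<length bs. (matrix_in_basis scale S bs \<phi> $$ (l, j)) *s (bs ! l)) \<in> S"
    if "j < length bs"
    using P that lc unfolding n_def by metis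
qed

end

section \<open>Monoid algebras\<close>

lemma single_sum_keys:
  fixes f :: "'m \<Rightarrow>\<^sub>0 'a::comm_monoid_add"
  shows "(\<Sum>u\<in>Poly_Mapping.keys f. Poly_Mapping.single u (Poly_Mapping.lookup f u)) = f"
  by (rule poly_mapping_eqI) (simp add: lookup_sum lookup_single when_def in_keys_iff)

lemma poly_mapping_add_induct [case_names zero single add]:
  fixes P :: "('m \<Rightarrow>\<^sub>0 'a::comm_monoid_add) \<Rightarrow> bool"
  assumes "P 0" "\<And>u c. P (Poly_Mapping.single u c)" "\<And>f g. P f \<Longrightarrow> P g \<Longrightarrow> P (f + g)"
  shows "P f"
proof -
  have "P (\<Sum>u\<in>K. Poly_Mapping.single u (Poly_Mapping.lookup f u))" for K
    by (induction K rule: infinite_finite_induct) (auto intro: assms)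
  then show ?thesis using single_sum_keys[of f] by metis
qed

interpretation pm: Modules.module "scale :: 'a::comm_ring_1 \<Rightarrow> ('m::monoid_add \<Rightarrow>\<^sub>0 'a) \<Rightarrow> _"
  by unfold_locales
    (simp_all add: scale_def const_def distrib_left distrib_right single_add mult_single
      flip: mult.assoc)

lemma subspace_left_ideal: "left_ideal J \<Longrightarrow> pm.subspace J"
  unfolding left_ideal_def pm.subspace_def scale_def by blast

lemma scale_single: "scale c (Poly_Mapping.single u a) = Poly_Mapping.single u (c * a)"
  by (simp add: scale_def const_def mult_single)

lemma scale_mon: "scale c (mon u) = Poly_Mapping.single u c"
  by (simp add: mon_def scale_single)

lemma mon_mult: "mon u * mon v = mon (u + v)"
  by (simp add: mon_def mult_single)

lemma scale_mult_right:
  fixes f g :: "'m::comm_monoid_add \<Rightarrow>\<^sub>0 'a::comm_ring_1"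
  shows "f * scale c g = scale c (f * g)"
  by (simp add: scale_def mult.left_commute)

lemma var_power: "var v ^ k = mon (Poly_Mapping.single v k)"
  by (induction k) (simp_all add: mon_def var_def mult_single flip: single_add)

lemma prod_mon: "(\<Prod>i\<in>K. mon (e i)) = mon (\<Sum>i\<in>K. e i)"
  by (induction K rule: infinite_finite_induct) (simp_all add: mon_mult, simp_all add: mon_def)

text \<open>
  The linear map to the coefficient ring with prescribed values on monomials. Vectors are handled one
  coordinate at a time, so scalar values suffice.
\<close>

definition linear_extension :: "('m \<Rightarrow> 'a::comm_ring_1) \<Rightarrow> ('m \<Rightarrow>\<^sub>0 'a) \<Rightarrow> 'a" where
  "linear_extension p f = (\<Sum>u\<in>Poly_Mapping.keys f. Poly_Mapping.lookup f u * p u)"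

lemma linear_extension_superset:
  assumes "finite K" "Poly_Mapping.keys f \<subseteq> K"
  shows "linear_extension p f = (\<Sum>u\<in>K. Poly_Mapping.lookup f u * p u)"
  unfolding linear_extension_def using assms
  by (intro sum.mono_neutral_left) (auto simp: in_keys_iff)

lemma linear_extension_zero [simp]: "linear_extension p 0 = 0"
  by (simp add: linear_extension_def)

lemma linear_extension_add: "linear_extension p (f + g) = linear_extension p f + linear_extension p g"
proof -
  let ?K = "Poly_Mapping.keys f \<union> Poly_Mapping.keys g"
  have "linear_extension p (f + g) = (\<Sum>u\<in>?K. Poly_Mapping.lookup (f + g) u * p u)"
    by (rule linear_extension_superset) (auto simp: Poly_Mapping.keys_add)
  also have "\<dots> = linear_extension p f + linear_extension p g"
    by (simp add: linear_extension_superset[of ?K] lookup_add distrib_right sum.distrib)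
  finally show ?thesis .
qed

lemma linear_extension_single: "linear_extension p (Poly_Mapping.single u c) = c * p u"
  by (simp add: linear_extension_superset[of "{u}"])

lemma linear_extension_mon [simp]: "linear_extension p (mon u) = p u"
  by (simp add: mon_def linear_extension_single)

lemma linear_extension_sum: "linear_extension p (sum f K) = (\<Sum>k\<in>K. linear_extension p (f k))"
  by (induction K rule: infinite_finite_induct) (simp_all add: linear_extension_add)

lemma linear_extension_scale:
  fixes f :: "'m::monoid_add \<Rightarrow>\<^sub>0 'a::comm_ring_1"
  shows "linear_extension p (scale c f) = c * linear_extension p f"
  by (induction f rule: poly_mapping_add_induct)
    (simp_all add: scale_single linear_extension_single linear_extension_add pm.scale_right_distrib
      distrib_left mult.assoc)

lemma linear_extension_diff:
  fixes f :: "'m::monoid_add \<Rightarrow>\<^sub>0 'a::comm_ring_1"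
  shows "linear_extension p (f - g) = linear_extension p f - linear_extension p g"
  using linear_extension_add[of p "f - g" g] by simp

section \<open>Degrees and exponents\<close>

lemma mdeg_superset:
  assumes "finite K" "Poly_Mapping.keys u \<subseteq> K"
  shows "mdeg u = (\<Sum>i\<in>K. Poly_Mapping.lookup u i)"
  unfolding mdeg_def using assms by (intro sum.mono_neutral_left) (auto simp: in_keys_iff)

lemma mdeg_add: "mdeg (u + v) = mdeg u + mdeg v"
proof -
  let ?K = "Poly_Mapping.keys u \<union> Poly_Mapping.keys v"
  have "mdeg (u + v) = (\<Sum>i\<in>?K. Poly_Mapping.lookup (u + v) i)"
    by (rule mdeg_superset) (auto simp: Poly_Mapping.keys_add)
  also have "\<dots> = mdeg u + mdeg v"
    by (simp add: mdeg_superset[of ?K] lookup_add sum.distrib)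
  finally show ?thesis .
qed

lemma mdeg_zero [simp]: "mdeg 0 = 0"
  by (simp add: mdeg_def)

lemma mdeg_single [simp]: "mdeg (Poly_Mapping.single i k) = k"
  by (simp add: mdeg_superset[of "{i}"])

lemma mdeg_sum: "mdeg (sum f K) = (\<Sum>k\<in>K. mdeg (f k))"
  by (induction K rule: infinite_finite_induct) (simp_all add: mdeg_add)

definition x_exponent :: "'n list \<Rightarrow> ('n hvar \<Rightarrow>\<^sub>0 nat)" where
  "x_exponent w = (\<Sum>i\<leftarrow>w. Poly_Mapping.single (X i) 1)"

lemma x_exponent_simps [simp]:
  "x_exponent [] = 0" "x_exponent (i # w) = Poly_Mapping.single (X i) 1 + x_exponent w"
  by (simp_all add: x_exponent_def)

lemma lookup_x_exponent [simp]:
  "Poly_Mapping.lookup (x_exponent w) (X i) = count (mset w) i"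
  "Poly_Mapping.lookup (x_exponent w) Z = 0"
  by (induction w) (auto simp: lookup_add lookup_single when_def)

lemma mdeg_x_exponent [simp]: "mdeg (x_exponent w) = length w"
  by (induction w) (simp_all add: mdeg_add)

definition homogenized_exponent :: "nat \<Rightarrow> 'n::finite monomial \<Rightarrow> ('n hvar \<Rightarrow>\<^sub>0 nat)" where
  "homogenized_exponent e l = Poly_Mapping.single Z (e - mdeg l)
     + (\<Sum>i\<in>UNIV. Poly_Mapping.single (X i) (Poly_Mapping.lookup l i))"

lemma homogenize_mono_eq_mon: "homogenize_mono e l = mon (homogenized_exponent e l)"
  by (simp add: homogenize_mono_def homogenized_exponent_def var_power prod_mon mon_mult)

lemma lookup_homogenized_exponent [simp]:
  "Poly_Mapping.lookup (homogenized_exponent e l) (X i) = Poly_Mapping.lookup l i"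
  by (simp add: homogenized_exponent_def lookup_add lookup_single lookup_sum when_def)

lemma mdeg_homogenized_exponent: "mdeg l \<le> e \<Longrightarrow> mdeg (homogenized_exponent e l) = e"
  by (simp add: homogenized_exponent_def mdeg_add mdeg_sum flip: mdeg_superset[of UNIV l])

lemma homogenize_mono_Suc:
  "mdeg l \<le> e \<Longrightarrow> homogenize_mono (Suc e) l = var Z * homogenize_mono e l"
  by (simp add: homogenize_mono_def Suc_diff_le mult.assoc)

lemma mdeg_le_max_deg: "l \<in> set \<beta> \<Longrightarrow> mdeg l \<le> max_deg \<beta>"
  by (simp add: max_deg_def)

lemma mon_in_hom_comm_part: "mdeg u = e \<Longrightarrow> mon u \<in> hom_comm_part e"
  by (simp add: hom_comm_part_def mon_def)

lemma hom_comm_part_subset: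
  fixes S :: "('n, 'a::comm_ring_1) hom_comm_poly set"
  assumes S: "pm.subspace S" and m: "\<And>u. mdeg u = e \<Longrightarrow> mon u \<in> S"
  shows "hom_comm_part e \<subseteq> S"
proof
  fix f :: "('n, 'a) hom_comm_poly" assume f: "f \<in> hom_comm_part e"
  have "(\<Sum>u\<in>Poly_Mapping.keys f. scale (Poly_Mapping.lookup f u) (mon u)) \<in> S"
    using f by (intro pm.subspace_sum pm.subspace_scale S m) (auto simp: hom_comm_part_def)
  then show "f \<in> S" by (simp add: scale_mon single_sum_keys)
qed

section \<open>Dehomogenization and the canonical maps\<close>

lemma lookup_dehomogenize [simp]:
  "Poly_Mapping.lookup (dehomogenize g) w = poly (Poly_Mapping.lookup g w) 1"
  unfolding dehomogenize_def by (simp add: Poly_Mapping.map.rep_eq when_def)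

lemma dehomogenize_zero [simp]: "dehomogenize 0 = 0"
  by (rule poly_mapping_eqI) simp

lemma dehomogenize_add: "dehomogenize (f + g) = dehomogenize f + dehomogenize g"
  by (rule poly_mapping_eqI) (simp add: lookup_add)

lemma dehomogenize_sum: "dehomogenize (sum f K) = (\<Sum>k\<in>K. dehomogenize (f k))"
  by (induction K rule: infinite_finite_induct) (simp_all add: dehomogenize_add)

lemma dehomogenize_single: "dehomogenize (Poly_Mapping.single w p) = Poly_Mapping.single w (poly p 1)"
  by (rule poly_mapping_eqI) (simp add: lookup_single when_def)

lemma dehomogenize_single_mult:
  "dehomogenize (Poly_Mapping.single w p * g) = Poly_Mapping.single w (poly p 1) * dehomogenize g"
  by (induction g rule: poly_mapping_add_induct)
    (simp_all add: mult_single dehomogenize_single dehomogenize_add distrib_left)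

lemma hom_free_part_zero: "0 \<in> hom_free_part e"
  by (simp add: hom_free_part_def)

lemma hom_free_part_add: "f \<in> hom_free_part e \<Longrightarrow> g \<in> hom_free_part e \<Longrightarrow> f + g \<in> hom_free_part e"
  unfolding hom_free_part_def by (simp add: lookup_add) (metis add_0)

text \<open>
  Multiplying by \<open>z\<close> raises the degree of a homogeneous element without changing its
  dehomogenization, and multiplying by a word acts on the dehomogenization as that word; both are
  cases of this degree count.
\<close>

lemma hom_free_part_monom_mult:
  assumes g: "g \<in> hom_free_part e"
  shows "Poly_Mapping.single w (monom c k) * g \<in> hom_free_part (k + length (letters w) + e)"
proof -
  let ?s = "Poly_Mapping.single w (monom c k)"
  have "(\<Sum>u\<in>K. ?s * Poly_Mapping.single u (Poly_Mapping.lookup g u))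
      \<in> hom_free_part (k + length (letters w) + e)" for K
  proof (induction K rule: infinite_finite_induct)
    case (insert u K)
    have "?s * Poly_Mapping.single u (Poly_Mapping.lookup g u) \<in> hom_free_part (k + length (letters w) + e)"
    proof -
      let ?p = "Poly_Mapping.lookup g u"
      have deg: "j - k + length (letters u) = e" if "c * coeff ?p (j - k) \<noteq> 0" for j
      proof -
        have "coeff ?p (j - k) \<noteq> 0" using that by auto
        then show ?thesis using g unfolding hom_free_part_def by blast
      qed
      show ?thesis
        unfolding hom_free_part_def
      proof (intro CollectI allI impI)
        fix w' j assume nz: "coeff (Poly_Mapping.lookup (?s * Poly_Mapping.single u ?p) w') j \<noteq> 0"
        then have w': "w' = w + u" by (auto simp: mult_single lookup_single when_def split: if_splits)
        then have "k \<le> j" "c * coeff ?p (j - k) \<noteq> 0"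
          using nz by (auto simp: mult_single coeff_monom_mult split: if_splits)
        then show "j + length (letters w') = k + length (letters w) + e"
          using deg[of j] by (simp add: w' plus_fword_def)
      qed
    qed
    then show ?case using insert by (simp add: hom_free_part_add)
  qed (simp_all add: hom_free_part_zero)
  from this[of "Poly_Mapping.keys g"] show ?thesis
    by (simp add: single_sum_keys flip: sum_distrib_left)
qed

lemma degree_zero_localizationI:
  "g \<in> J \<Longrightarrow> g \<in> hom_free_part e \<Longrightarrow> dehomogenize g \<in> degree_zero_localization J"
  by (auto simp: degree_zero_localization_def)

text \<open>
  Two fractions are added over a common power of \<open>z\<close>. Left multiplication by a word \<open>w\<close> in the \<open>t\<^sub>i\<close> is
  induced by the word \<open>w\<close> in the \<open>x\<^sub>i\<close>, which is homogeneous.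
\<close>

lemma left_ideal_degree_zero_localization:
  assumes J: "left_ideal J"
  shows "left_ideal (degree_zero_localization J)" (is "left_ideal ?I")
proof -
  have shift: "\<exists>g'\<in>J. g' \<in> hom_free_part (k + e) \<and> dehomogenize g' = dehomogenize g"
    if "g \<in> J" "g \<in> hom_free_part e" for g e k
  proof (intro bexI conjI)
    let ?z = "Poly_Mapping.single 0 (monom 1 k)"
    show "?z * g \<in> J" using J that by (simp add: left_ideal_def)
    show "?z * g \<in> hom_free_part (k + e)"
      using hom_free_part_monom_mult[OF that(2), of 0 1 k] by (simp add: zero_fword_def)
    show "dehomogenize (?z * g) = dehomogenize g"
      by (simp add: dehomogenize_single_mult poly_monom)
  qed
  have add: "x + y \<in> ?I" if "x \<in> ?I" "y \<in> ?I" for x y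
  proof -
    obtain g e h e' where g: "g \<in> J" "g \<in> hom_free_part e" "x = dehomogenize g"
      and h: "h \<in> J" "h \<in> hom_free_part e'" "y = dehomogenize h"
      using \<open>x \<in> ?I\<close> \<open>y \<in> ?I\<close> unfolding degree_zero_localization_def by blast
    obtain g' where g': "g' \<in> J" "g' \<in> hom_free_part (e' + e)" "dehomogenize g' = x"
      using shift[OF g(1,2), of e'] g(3) by auto
    obtain h' where h': "h' \<in> J" "h' \<in> hom_free_part (e' + e)" "dehomogenize h' = y"
      using shift[OF h(1,2), of e] h(3) by (auto simp: add.commute)
    have "g' + h' \<in> J" using J g'(1) h'(1) by (simp add: left_ideal_def)
    then show ?thesis
      using degree_zero_localizationI[OF _ hom_free_part_add[OF g'(2) h'(2)], of J] g'(3) h'(3)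
      by (simp add: dehomogenize_add)
  qed
  have zero: "0 \<in> ?I"
    using degree_zero_localizationI[of 0 J, OF _ hom_free_part_zero] J by (simp add: left_ideal_def)
  have "r * x \<in> ?I" if x: "x \<in> ?I" for r x
  proof (induction r rule: poly_mapping_add_induct)
    case (single w c)
    obtain g e where g: "g \<in> J" "g \<in> hom_free_part e" "x = dehomogenize g"
      using x unfolding degree_zero_localization_def by blast
    let ?g = "Poly_Mapping.single w (monom c 0) * g"
    have "?g \<in> J" using J g(1) by (simp add: left_ideal_def)
    moreover have "dehomogenize ?g = Poly_Mapping.single w c * x"
      by (simp add: dehomogenize_single_mult poly_monom g(3))
    ultimately show ?case
      using degree_zero_localizationI[OF _ hom_free_part_monom_mult[OF g(2), of w c 0], of J] by simp
  qed (use zero add in \<open>auto simp: distrib_right\<close>)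
  then show ?thesis using zero add by (simp add: left_ideal_def)
qed

lemma hom_comm_image_eq_sum:
  fixes g :: "('n, 'a::comm_ring_1) hom_free_alg"
  shows "hom_comm_image g = (\<Sum>w\<in>Poly_Mapping.keys g. \<Sum>k\<le>degree (Poly_Mapping.lookup g w).
     Poly_Mapping.single (Poly_Mapping.single Z k + x_exponent (letters w)) (coeff (Poly_Mapping.lookup g w) k))"
proof -
  have word: "prod_list (map (\<lambda>i. var (X i)) w) = (mon (x_exponent w) :: ('n, 'a) hom_comm_poly)"
    for w :: "'n list"
    by (induction w) (simp_all add: var_def mon_mult, simp add: mon_def)
  have deg: "degree (map_poly const p) = degree p"
    for p :: "'a poly"
    by (rule degree_map_poly) (metis const_def lookup_single_eq lookup_zero)
  have "poly (map_poly const p) (var Z) * mon u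
      = (\<Sum>k\<le>degree p. Poly_Mapping.single (Poly_Mapping.single Z k + u) (coeff p k))"
    for p :: "'a poly" and u :: "'n hvar \<Rightarrow>\<^sub>0 nat"
    by (simp add: poly_altdef deg coeff_map_poly const_def var_power mon_def mult_single sum_distrib_right)
  then show ?thesis unfolding hom_comm_image_def word by simp
qed

lemma comm_image_mon_eq_mon_iff:
  "(comm_image (mon w) :: ('n, 'a::comm_ring_1) comm_poly) = mon l \<longleftrightarrow>
     (\<forall>i. count (mset (letters w)) i = Poly_Mapping.lookup l i)"
proof -
  have word: "prod_list (map var v) = (mon (\<Sum>i\<leftarrow>v. Poly_Mapping.single i 1) :: ('n, 'a) comm_poly)" for v
    by (induction v) (simp_all add: var_def mon_mult, simp add: mon_def)
  have lookup: "Poly_Mapping.lookup (\<Sum>i\<leftarrow>v. Poly_Mapping.single i 1) j = count (mset v) j" for v :: "'n list" and j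
    by (induction v) (auto simp: lookup_add lookup_single when_def)
  have inj: "(mon u :: ('n, 'a) comm_poly) = mon l \<longleftrightarrow> u = l" for u
    by (metis mon_def lookup_single_eq lookup_single_not_eq zero_neq_one)
  have image: "comm_image (mon w) = (mon (\<Sum>i\<leftarrow>letters w. Poly_Mapping.single i 1) :: ('n, 'a) comm_poly)"
    unfolding comm_image_def word by (simp add: mon_def const_def)
  show ?thesis unfolding image inj
    by (simp add: poly_mapping_eq_iff fun_eq_iff lookup del: One_nat_def)
qed

section \<open>Words acting through matrices\<close>

text \<open>
  The product of the matrices \<open>T i\<close> along a word, applied to a vector. A vector or matrix is a function
  on natural numbers, of which only the arguments below \<open>N\<close> matter.
\<close>

primrec word_action ::
    "nat \<Rightarrow> ('n \<Rightarrow> nat \<Rightarrow> nat \<Rightarrow> 'a) \<Rightarrow> 'n list \<Rightarrow> (nat \<Rightarrow> 'a::comm_ring_1) \<Rightarrow> nat \<Rightarrow> 'a" where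
  "word_action N T [] v = v"
| "word_action N T (i # w) v = (\<lambda>l. \<Sum>k<N. T i l k * word_action N T w v k)"

lemma word_action_append:
  "word_action N T (w @ w') v = word_action N T w (word_action N T w' v)"
  by (induction w) auto

lemma word_action_add:
  "word_action N T w (\<lambda>k. v k + v' k) l = word_action N T w v l + word_action N T w v' l"
  by (induction w arbitrary: l) (auto simp: distrib_left sum.distrib)

lemma word_action_scale:
  "word_action N T w (\<lambda>k. c * v k) l = c * word_action N T w v l"
  by (induction w arbitrary: l) (auto simp: sum_distrib_left mult.left_commute)

locale commuting_action = ring_ideal A for A :: "'a::comm_ring_1 set" +
  fixes N :: nat and T :: "'n::finite \<Rightarrow> nat \<Rightarrow> nat \<Rightarrow> 'a" and v :: "nat \<Rightarrow> 'a"
  assumes commute: "l < N \<Longrightarrow> k < N \<Longrightarrow> (\<Sum>j<N. T i l j * T i' j k) \<approx> (\<Sum>j<N. T i' l j * T i j k)"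
begin

abbreviation act :: "'n list \<Rightarrow> nat \<Rightarrow> 'a" where
  "act w \<equiv> word_action N T w v"

lemma word_action_cong:
  "(\<And>k. k < N \<Longrightarrow> x k \<approx> y k) \<Longrightarrow> l < N \<Longrightarrow> word_action N T w x l \<approx> word_action N T w y l"
  by (induction w arbitrary: l) (auto intro!: cong_sum cong_mult)

lemma act_swap: "l < N \<Longrightarrow> act (i # j # w) l \<approx> act (j # i # w) l"
proof -
  assume l: "l < N"
  have eq: "act (i # j # w) l = (\<Sum>k<N. (\<Sum>k'<N. T i l k' * T j k' k) * act w k)" for i j
    by (simp add: sum_distrib_left sum_distrib_right mult.assoc) (rule sum.swap)
  show ?thesis unfolding eq by (intro cong_sum cong_mult commute l cong_refl) simp
qed

lemma act_move: "l < N \<Longrightarrow> act (w @ i # w') l \<approx> act (i # w @ w') l"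
proof (induction w arbitrary: l)
  case (Cons j w)
  have "act ((j # w) @ i # w') l \<approx> act (j # i # w @ w') l"
    using Cons.IH by (auto intro!: cong_sum cong_mult)
  also have "act (j # i # w @ w') l \<approx> act (i # j # w @ w') l" by (rule act_swap[OF Cons.prems])
  finally show ?case by simp
qed simp

lemma act_mset: "mset w = mset w' \<Longrightarrow> l < N \<Longrightarrow> act w l \<approx> act w' l"
proof (induction w arbitrary: w' l)
  case (Cons i w)
  then have "i \<in> set w'" by (metis list.set_intros(1) mset_eq_setD)
  then obtain u u' where w': "w' = u @ i # u'" by (meson split_list)
  then have "mset w = mset (u @ u')" using Cons.prems(1) by simp
  then have "act (i # w) l \<approx> act (i # u @ u') l"
    using Cons.IH by (auto intro!: cong_sum cong_mult)
  also have "act (i # u @ u') l \<approx> act w' l"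
    unfolding w' by (rule cong_sym[OF act_move[OF Cons.prems(2)]])
  finally show ?case .
qed simp

text \<open>
  Some word in the \<open>x\<^sub>i\<close> with the same exponents as the monomial; the exponent of \<open>z\<close> is dropped because
  \<open>z\<close> is to act as the identity. The choice does not matter modulo \<open>A\<close>.
\<close>

definition x_word :: "('n hvar \<Rightarrow>\<^sub>0 nat) \<Rightarrow> 'n list" where
  "x_word u = (SOME w. \<forall>i. count (mset w) i = Poly_Mapping.lookup u (X i))"

lemma count_x_word: "count (mset (x_word u)) i = Poly_Mapping.lookup u (X i)"
proof -
  have "finite {i. Poly_Mapping.lookup u (X i) > 0}"
    using finite_vimageI[OF finite_lookup[of u], of X] by (auto simp: inj_on_def vimage_def)
  then have "count (Abs_multiset (\<lambda>i. Poly_Mapping.lookup u (X i))) i = Poly_Mapping.lookup u (X i)" for i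
    by simp
  moreover obtain w where "mset w = Abs_multiset (\<lambda>i. Poly_Mapping.lookup u (X i))"
    using ex_mset by blast
  ultimately have "\<exists>w. \<forall>i. count (mset w) i = Poly_Mapping.lookup u (X i)" by metis
  then show ?thesis unfolding x_word_def by (rule someI2_ex) blast
qed

definition monomial_value :: "('n hvar \<Rightarrow>\<^sub>0 nat) \<Rightarrow> nat \<Rightarrow> 'a" where
  "monomial_value u = act (x_word u)"

definition hom_value :: "('n, 'a) hom_comm_poly \<Rightarrow> nat \<Rightarrow> 'a" where
  "hom_value f l = linear_extension (\<lambda>u. monomial_value u l) f"

definition free_value :: "('n, 'a) free_alg \<Rightarrow> nat \<Rightarrow> 'a" where
  "free_value f l = linear_extension (\<lambda>w. act (letters w) l) f"

lemmas hom_value_simps = hom_value_def linear_extension_add linear_extension_single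
  linear_extension_sum linear_extension_scale linear_extension_diff

lemmas free_value_simps = free_value_def linear_extension_add linear_extension_single
  linear_extension_sum linear_extension_scale linear_extension_diff

lemma monomial_value_eq_act:
  assumes "\<And>i. count (mset w) i = Poly_Mapping.lookup u (X i)" "l < N"
  shows "monomial_value u l \<approx> act w l"
  unfolding monomial_value_def using assms by (intro act_mset) (auto intro!: multiset_eqI simp: count_x_word)

lemma monomial_value_add:
  "l < N \<Longrightarrow> monomial_value (u + u') l \<approx> word_action N T (x_word u) (monomial_value u') l"
  unfolding monomial_value_def word_action_append[symmetric]
  by (intro act_mset) (auto intro!: multiset_eqI simp: count_x_word lookup_add)

lemma hom_value_single_mult:
  assumes "l < N"
  shows "hom_value (Poly_Mapping.single u c * f) l \<approx> c * word_action N T (x_word u) (hom_value f) l"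
proof (induction f rule: poly_mapping_add_induct)
  case zero
  have "word_action N T w (\<lambda>k. 0) l = 0" for w
    using word_action_scale[of N T w 0 "\<lambda>k. 0" l] by simp
  then show ?case by (simp add: hom_value_def)
next
  case (single u' c')
  have "c * c' * monomial_value (u + u') l \<approx> c * c' * word_action N T (x_word u) (monomial_value u') l"
    by (intro cong_mult monomial_value_add assms cong_refl)
  then show ?case
    by (simp add: mult_single hom_value_simps[abs_def] word_action_scale mult.assoc)
next
  case (add f g)
  from cong_add[OF add] show ?case
    by (simp add: hom_value_simps[abs_def] distrib_left word_action_add)
qed

text \<open>
  Multiplication by a monomial acts on values, modulo \<open>A\<close>, through the matrices, and these preserve
  vectors with entries in \<open>A\<close>. Vanishing modulo \<open>A\<close> on generators of an ideal therefore extends to the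
  ideal.
\<close>

lemma left_ideal_hom_value: "left_ideal {f. \<forall>l<N. hom_value f l \<in> A}"
proof -
  have mult: "\<forall>l<N. hom_value (r * f) l \<in> A" if f: "\<forall>l<N. hom_value f l \<in> A" for r f
  proof (induction r rule: poly_mapping_add_induct)
    case (single u c)
    show ?case
    proof (intro allI impI)
      fix l assume l: "l < N"
      have "word_action N T (x_word u) (hom_value f) l \<approx> word_action N T (x_word u) (\<lambda>k. 0 * 0) l"
        using f l by (intro word_action_cong) (auto simp: cong_zero_iff)
      then have "word_action N T (x_word u) (hom_value f) l \<in> A"
        unfolding word_action_scale by (simp add: cong_zero_iff)
      then have "c * word_action N T (x_word u) (hom_value f) l \<in> A" by (rule mult_mem)
      then show "hom_value (Poly_Mapping.single u c * f) l \<in> A"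
        using cong_trans[OF hom_value_single_mult[OF l]] cong_zero_iff by blast
    qed
  qed (auto simp: hom_value_simps distrib_right zero_mem add_mem)
  then show ?thesis
    unfolding left_ideal_def by (auto simp: zero_mem add_mem hom_value_simps)
qed

text \<open>
  On a term \<open>c z\<^sup>k w\<close> both sides are \<open>c\<close> times the action of \<open>w\<close>: dehomogenizing sets \<open>z = 1\<close>, and
  \<open>z\<close> acts as the identity.
\<close>

lemma free_value_dehomogenize:
  assumes l: "l < N"
  shows "free_value (dehomogenize g) l \<approx> hom_value (hom_comm_image g) l"
proof -
  let ?c = "\<lambda>w k. coeff (Poly_Mapping.lookup g w) k"
  have "free_value (dehomogenize g) l
      = (\<Sum>w\<in>Poly_Mapping.keys g. poly (Poly_Mapping.lookup g w) 1 * act (letters w) l)"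
    unfolding free_value_def
    by (subst linear_extension_superset[of "Poly_Mapping.keys g"]) (auto simp: in_keys_iff)
  also have "\<dots> = (\<Sum>w\<in>Poly_Mapping.keys g. \<Sum>k\<le>degree (Poly_Mapping.lookup g w). ?c w k * act (letters w) l)"
    by (simp add: poly_altdef sum_distrib_right)
  also have "\<dots> \<approx> (\<Sum>w\<in>Poly_Mapping.keys g. \<Sum>k\<le>degree (Poly_Mapping.lookup g w).
      ?c w k * monomial_value (Poly_Mapping.single Z k + x_exponent (letters w)) l)"
    using l by (intro cong_sum cong_mult cong_refl cong_sym[OF monomial_value_eq_act])
      (auto simp: lookup_add lookup_single)
  also have "\<dots> = hom_value (hom_comm_image g) l"
    unfolding hom_comm_image_eq_sum by (simp add: hom_value_simps)
  finally show ?thesis .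
qed

lemma hom_value_homogenize_mono:
  assumes "\<And>i. count (mset w) i = Poly_Mapping.lookup u i" "l < N"
  shows "hom_value (homogenize_mono e u) l \<approx> act w l"
  unfolding homogenize_mono_eq_mon hom_value_def linear_extension_mon
  using assms by (intro monomial_value_eq_act) auto

end

section \<open>Bases of a graded quotient in a fixed degree\<close>

text \<open>
  The bound on degrees is strict: then \<open>z\<close> divides every member of \<open>z\<^sup>d\<beta>\<close>, and \<open>x\<^sub>i z\<^bsup>d-1\<^esup> l\<close> makes sense and
  has degree \<open>d\<close> for \<open>l\<close> in \<open>\<beta>\<close>.
\<close>

locale degree_basis =
  fixes J :: "('n::finite, 'a::comm_ring_1) hom_comm_poly set"
    and \<beta> :: "'n monomial list" and d :: nat
  assumes ideal: "left_ideal J"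
    and degree: "l \<in> set \<beta> \<Longrightarrow> mdeg l < d"
    and basis: "is_basis scale (hom_comm_part d) J (map (homogenize_mono d) \<beta>)"
    and d_pos: "0 < d"
begin

abbreviation N :: nat where "N \<equiv> length \<beta>"

abbreviation H :: "nat \<Rightarrow> nat \<Rightarrow> ('n, 'a) hom_comm_poly" where
  "H e k \<equiv> homogenize_mono e (\<beta> ! k)"

abbreviation comb :: "nat \<Rightarrow> (nat \<Rightarrow> 'a) \<Rightarrow> ('n, 'a) hom_comm_poly" where
  "comb e c \<equiv> (\<Sum>k<N. scale (c k) (H e k))"

lemma sub: "pm.subspace J"
  by (rule subspace_left_ideal[OF ideal])

lemma mult_mem_J: "f \<in> J \<Longrightarrow> r * f \<in> J"
  using ideal by (simp add: left_ideal_def)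

lemma H_Suc: "k < N \<Longrightarrow> d \<le> Suc e \<Longrightarrow> H (Suc e) k = var Z * H e k"
  using degree[of "\<beta> ! k"] by (intro homogenize_mono_Suc) auto

lemma var_mult_H_in_part: "k < N \<Longrightarrow> d \<le> Suc e \<Longrightarrow> var y * H e k \<in> hom_comm_part (Suc e)"
  using degree[of "\<beta> ! k"]
  by (auto simp: var_def homogenize_mono_eq_mon mon_mult mdeg_add mdeg_homogenized_exponent
      intro!: mon_in_hom_comm_part)

lemma comb_Suc: "d \<le> Suc e \<Longrightarrow> comb (Suc e) c = var Z * comb e c"
  by (simp add: sum_distrib_left scale_mult_right H_Suc)

lemma comb_diff: "comb e c - comb e c' = comb e (\<lambda>k. c k - c' k)"
  by (simp add: pm.scale_left_diff_distrib sum_subtractf)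

lemma comb_add: "comb e c + comb e c' = comb e (\<lambda>k. c k + c' k)"
  by (simp add: pm.scale_left_distrib sum.distrib)

lemma comb_scale: "scale a (comb e c) = comb e (\<lambda>k. a * c k)"
  by (simp add: pm.scale_sum_right)

lemma coordinates_unique: "comb d c \<in> J \<Longrightarrow> l < N \<Longrightarrow> c l = 0"
  using pm.basis_coordinates_unique[OF basis, of c l] by simp

lemma coordinates_exist: "f \<in> hom_comm_part d \<Longrightarrow> \<exists>c. f - comb d c \<in> J"
  using basis unfolding is_basis_def generates_def lincomb_def by fastforce

definition spanned :: "nat \<Rightarrow> ('n, 'a) hom_comm_poly set" where
  "spanned e = {f. \<exists>c. f - comb e c \<in> J}"

lemma spannedI: "f - comb e c \<in> J \<Longrightarrow> f \<in> spanned e"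
  unfolding spanned_def by auto

lemma subspace_spanned: "pm.subspace (spanned e)"
proof (rule pm.subspaceI)
  have "0 - comb e (\<lambda>_. 0) \<in> J" by (simp add: pm.subspace_0[OF sub])
  then show "0 \<in> spanned e" by (rule spannedI)
  fix f g a assume "f \<in> spanned e"
  then obtain c where c: "f - comb e c \<in> J" by (auto simp: spanned_def)
  have "scale a f - comb e (\<lambda>k. a * c k) \<in> J"
    using pm.subspace_scale[OF sub c, of a] by (simp only: pm.scale_right_diff_distrib comb_scale)
  then show "scale a f \<in> spanned e" by (rule spannedI)
  assume "g \<in> spanned e"
  then obtain c' where c': "g - comb e c' \<in> J" by (auto simp: spanned_def)
  have "(f + g) - (comb e c + comb e c') \<in> J"
    using pm.subspace_add[OF sub c c'] by (simp add: algebra_simps)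
  then show "f + g \<in> spanned e" unfolding comb_add by (rule spannedI)
qed

lemma J_subset_spanned: "J \<subseteq> spanned e"
proof
  fix f assume "f \<in> J"
  then have "f - comb e (\<lambda>_. 0) \<in> J" by simp
  then show "f \<in> spanned e" by (rule spannedI)
qed

lemma Z_mult_spanned: "d \<le> Suc e \<Longrightarrow> f \<in> spanned e \<Longrightarrow> var Z * f \<in> spanned (Suc e)"
  using mult_mem_J[of _ "var Z"] unfolding spanned_def
  by (auto simp: comb_Suc right_diff_distrib[symmetric])

text \<open>
  A monomial of degree \<open>e + 1\<close> is a variable times a monomial of degree \<open>e\<close>, and the latter is a
  combination of \<open>z\<^sup>e\<beta>\<close>. As \<open>z\<close> divides the members of \<open>z\<^sup>e\<beta>\<close>, the product is \<open>z\<close> times an element of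
  degree \<open>e\<close>, and this element is again a combination of \<open>z\<^sup>e\<beta>\<close>.
\<close>

lemma hom_comm_part_spanned: "hom_comm_part (d + m) \<subseteq> spanned (d + m)"
proof (induction m)
  case 0
  then show ?case using coordinates_exist by (auto simp: spanned_def)
next
  case (Suc m)
  define e where "e = d + m"
  have IH: "hom_comm_part e \<subseteq> spanned e" using Suc e_def by simp
  have "mon u \<in> spanned (Suc e)" if u: "mdeg u = Suc e" for u :: "'n hvar \<Rightarrow>\<^sub>0 nat"
  proof -
    have "u \<noteq> 0" using u by auto
    then obtain y where y: "Poly_Mapping.lookup u y \<noteq> 0" by (metis poly_mapping_eqI lookup_zero)
    define u' where "u' = u - Poly_Mapping.single y 1"
    have u_eq: "u = Poly_Mapping.single y 1 + u'"
      using y by (intro poly_mapping_eqI) (auto simp: u'_def lookup_add lookup_minus lookup_single when_def)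
    have split: "mon u = (var y * mon u' :: ('n, 'a) hom_comm_poly)"
      by (simp add: u_eq var_def mon_mult)
    have "mon u' \<in> hom_comm_part e"
      using u by (intro mon_in_hom_comm_part) (simp add: u_eq mdeg_add)
    then have sp: "(mon u' :: ('n, 'a) hom_comm_poly) \<in> spanned e" using IH by blast
    then obtain c where c: "(mon u' :: ('n, 'a) hom_comm_poly) - comb e c \<in> J"
      by (auto simp: spanned_def)
    have "var y * comb e c \<in> spanned (Suc e)"
    proof -
      obtain e' where e': "e = Suc e'" using d_pos unfolding e_def by (cases "d + m") auto
      have "var y * H e k \<in> spanned (Suc e)" if k: "k < N" for k
      proof -
        have "d \<le> Suc e'" unfolding e'[symmetric] e_def by simp
        then have "var y * H e k = var Z * (var y * H e' k)" "var y * H e' k \<in> hom_comm_part e"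
          using H_Suc[OF k] var_mult_H_in_part[OF k] by (simp_all add: e' mult.left_commute)
        then show ?thesis using IH Z_mult_spanned[of e "var y * H e' k"] by (auto simp: e_def)
      qed
      then have "(\<Sum>k<N. scale (c k) (var y * H e k)) \<in> spanned (Suc e)"
        by (intro pm.subspace_sum pm.subspace_scale subspace_spanned) auto
      then show ?thesis by (simp add: sum_distrib_left scale_mult_right)
    qed
    moreover have "var y * (mon u' - comb e c) \<in> spanned (Suc e)"
      using mult_mem_J[OF c] J_subset_spanned by blast
    ultimately have "var y * (mon u' - comb e c) + var y * comb e c \<in> spanned (Suc e)"
      using pm.subspace_add[OF subspace_spanned] by blast
    then show ?thesis by (simp add: split right_diff_distrib)
  qed
  then show ?case using hom_comm_part_subset[OF subspace_spanned] by (simp add: e_def)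
qed

lemma generates_above: "generates scale (hom_comm_part (d + m)) J (map (homogenize_mono (d + m)) \<beta>)"
  unfolding generates_def
proof (intro conjI ballI)
  show "set (map (homogenize_mono (d + m)) \<beta>) \<subseteq> hom_comm_part (d + m)"
    using degree by (force simp: homogenize_mono_eq_mon intro!: mon_in_hom_comm_part mdeg_homogenized_exponent)
  fix f :: "('n, 'a) hom_comm_poly" assume "f \<in> hom_comm_part (d + m)"
  then obtain c where "f - comb (d + m) c \<in> J" using hom_comm_part_spanned by (auto simp: spanned_def)
  then have "f - lincomb scale (map (homogenize_mono (d + m)) \<beta>) (vec N c) \<in> J"
    by (simp add: lincomb_def)
  then show "\<exists>c\<in>carrier_vec (length (map (homogenize_mono (d + m)) \<beta>)).
      f - lincomb scale (map (homogenize_mono (d + m)) \<beta>) c \<in> J"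
    by (intro bexI[of _ "vec N c"]) auto
qed

text \<open>
  The columns of \<open>M i\<close> are the coordinates of \<open>x\<^sub>i z\<^bsup>d-1\<^esup> l\<close> in degree \<open>d\<close>, that is, of \<open>x\<^sub>i/z\<close> applied to the basis.
\<close>

definition M :: "'n \<Rightarrow> nat \<Rightarrow> nat \<Rightarrow> 'a" where
  "M i l k = (SOME c. var (X i) * H (d - 1) k - comb d c \<in> J) l"

definition v :: "nat \<Rightarrow> 'a" where
  "v = (SOME c. mon (Poly_Mapping.single Z d) - comb d c \<in> J)"

lemma M_spec: "k < N \<Longrightarrow> var (X i) * H (d - 1) k - comb d (\<lambda>l. M i l k) \<in> J"
  unfolding M_def using var_mult_H_in_part[of k "d - 1" "X i"] d_pos
  by (intro someI_ex[OF coordinates_exist]) simp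

lemma v_spec: "mon (Poly_Mapping.single Z d) - comb d v \<in> J"
  unfolding v_def by (intro someI_ex[OF coordinates_exist] mon_in_hom_comm_part) simp

text \<open>
  Multiplication by \<open>x\<^sub>i\<close> from degree \<open>d\<close> to degree \<open>d + 1\<close> is multiplication by \<open>z\<close> after \<open>M i\<close>.
\<close>

lemma var_mult_coordinates:
  assumes f: "f - comb d c \<in> J"
  shows "var (X i) * f - comb (Suc d) (\<lambda>l. \<Sum>k<N. M i l k * c k) \<in> J"
proof -
  have "var (X i) * H d k - comb (Suc d) (\<lambda>l. M i l k) \<in> J" if k: "k < N" for k
  proof -
    have "H d k = var Z * H (d - 1) k" using H_Suc[OF k, of "d - 1"] d_pos by simp
    then have "var (X i) * H d k - comb (Suc d) (\<lambda>l. M i l k)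
        = var Z * (var (X i) * H (d - 1) k - comb d (\<lambda>l. M i l k))"
      using comb_Suc[of d] by (simp add: right_diff_distrib mult.left_commute)
    then show ?thesis using mult_mem_J[OF M_spec[OF k]] by simp
  qed
  from pm.combination_trans[OF sub this, where c = c and p = N]
  have "(\<Sum>k<N. scale (c k) (var (X i) * H d k)) - comb (Suc d) (\<lambda>l. \<Sum>k<N. c k * M i l k) \<in> J" .
  moreover have "var (X i) * f - (\<Sum>k<N. scale (c k) (var (X i) * H d k)) \<in> J"
    using mult_mem_J[OF f, of "var (X i)"] by (simp add: right_diff_distrib sum_distrib_left scale_mult_right)
  ultimately show ?thesis
    using pm.subspace_add[OF sub] by (fastforce simp: mult.commute)
qed

end

text \<open>
  The condition on \<open>A\<close> says that modulo \<open>A\<close> the generators \<open>z\<^bsup>d+1\<^esup>\<beta>\<close> in degree \<open>d + 1\<close> are independent, so that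
  coordinates in degree \<open>d + 1\<close> are unique modulo \<open>A\<close>.
\<close>

locale degree_basis_modulo = degree_basis J \<beta> d + ring_ideal A
  for J :: "('n::finite, 'a::comm_ring_1) hom_comm_poly set" and \<beta> d and A :: "'a set" +
  assumes relations_Suc: "comb (Suc d) c \<in> J \<Longrightarrow> l < N \<Longrightarrow> c l \<in> A"
begin

lemma coordinates_Suc_cong:
  assumes "f - comb (Suc d) c \<in> J" "f - comb (Suc d) c' \<in> J" "l < N"
  shows "c l \<approx> c' l"
proof -
  have "comb (Suc d) (\<lambda>k. c k - c' k) \<in> J"
    using pm.subspace_diff[OF sub assms(2,1)] by (simp flip: comb_diff)
  then show ?thesis unfolding cong_def by (rule relations_Suc) (rule assms)
qed

text \<open>
  Both products of \<open>M i\<close> and \<open>M j\<close> describe the coordinates in degree \<open>d + 1\<close> of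
  \<open>x\<^sub>i x\<^sub>j z\<^bsup>d-1\<^esup> l\<close>.
\<close>

sublocale commuting_action A N M v
proof
  fix i i' l k assume l: "l < N" and k: "k < N"
  have "var (X i) * (var (X i') * H (d - 1) k) - comb (Suc d) (\<lambda>l. \<Sum>j<N. M i l j * M i' j k) \<in> J"
    "var (X i) * (var (X i') * H (d - 1) k) - comb (Suc d) (\<lambda>l. \<Sum>j<N. M i' l j * M i j k) \<in> J"
    using var_mult_coordinates[OF M_spec[OF k], of i i'] var_mult_coordinates[OF M_spec[OF k], of i' i]
    by (simp_all add: mult.left_commute)
  from coordinates_Suc_cong[OF this l]
  show "(\<Sum>j<N. M i l j * M i' j k) \<approx> (\<Sum>j<N. M i' l j * M i j k)" .
qed

text \<open>
  Induction on the word: replacing a factor \<open>z\<close> by \<open>x\<^sub>i\<close> changes the coordinates in degree \<open>d\<close> by \<open>M i\<close>, since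
  \<open>z (x\<^sub>i g) = x\<^sub>i (z g)\<close> and coordinates in degree \<open>d + 1\<close> are unique modulo \<open>A\<close>.
\<close>

lemma word_coordinates:
  "length w \<le> d \<Longrightarrow> \<exists>c. mon (Poly_Mapping.single Z (d - length w) + x_exponent w) - comb d c \<in> J
     \<and> (\<forall>l<N. act w l \<approx> c l)"
proof (induction w)
  case Nil
  then show ?case using v_spec by (intro exI[of _ v]) simp
next
  case (Cons i w)
  define u where "u = Poly_Mapping.single Z (d - Suc (length w)) + x_exponent w"
  have eq: "Poly_Mapping.single Z (d - length w) + x_exponent w = Poly_Mapping.single Z 1 + u"
  proof -
    have "d - length w = 1 + (d - Suc (length w))" using Cons.prems by simp
    then show ?thesis unfolding u_def by (simp only: single_add add.assoc)
  qed
  obtain c where c: "mon (Poly_Mapping.single Z 1 + u) - comb d c \<in> J" and act: "\<forall>l<N. act w l \<approx> c l"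
    using Cons unfolding eq by auto
  have "mon (Poly_Mapping.single (X i) 1 + u) \<in> hom_comm_part d"
    using Cons.prems by (intro mon_in_hom_comm_part) (simp add: u_def mdeg_add)
  then obtain c' where c': "mon (Poly_Mapping.single (X i) 1 + u) - comb d c' \<in> J"
    using coordinates_exist by blast
  let ?f = "mon (Poly_Mapping.single (X i) 1 + (Poly_Mapping.single Z 1 + u)) :: ('n, 'a) hom_comm_poly"
  have "?f - comb (Suc d) (\<lambda>l. \<Sum>k<N. M i l k * c k) \<in> J"
    using var_mult_coordinates[OF c, of i] by (simp add: var_def mon_mult)
  moreover have "?f - comb (Suc d) c' \<in> J"
    using mult_mem_J[OF c', of "var Z"] comb_Suc[of d c']
    by (simp add: right_diff_distrib var_def mon_mult add.left_commute)
  ultimately have eq': "(\<Sum>k<N. M i l k * c k) \<approx> c' l" if "l < N" for l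
    using that by (rule coordinates_Suc_cong)
  have "act (i # w) l \<approx> c' l" if "l < N" for l
  proof -
    have "act (i # w) l \<approx> (\<Sum>k<N. M i l k * c k)" using act by (auto intro!: cong_sum cong_mult)
    also have "(\<Sum>k<N. M i l k * c k) \<approx> c' l" by (rule eq'[OF that])
    finally show ?thesis .
  qed
  then show ?case using c' by (intro exI[of _ c']) (simp add: u_def add.left_commute)
qed

lemma hom_value_coordinates:
  assumes f: "f \<in> hom_comm_part d" and c: "f - comb d c \<in> J" and l: "l < N"
  shows "hom_value f l \<approx> c l"
proof -
  define P where "P f c \<longleftrightarrow> f - comb d c \<in> J \<and> (\<forall>l<N. hom_value f l \<approx> c l)" for f c
  let ?S = "{f. \<exists>c. P f c}"
  have "hom_comm_part d \<subseteq> ?S"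
  proof (rule hom_comm_part_subset)
    show "pm.subspace ?S"
    proof (rule pm.subspaceI)
      have "P 0 (\<lambda>_. 0)" by (simp add: P_def pm.subspace_0[OF sub] hom_value_def)
      then show "0 \<in> ?S" by blast
      fix f g a assume "f \<in> ?S"
      then obtain c where c: "f - comb d c \<in> J" "\<forall>l<N. hom_value f l \<approx> c l"
        unfolding P_def by blast
      have "scale a f - comb d (\<lambda>k. a * c k) \<in> J"
        using pm.subspace_scale[OF sub c(1), of a] by (simp only: pm.scale_right_diff_distrib comb_scale)
      moreover have "\<forall>l<N. hom_value (scale a f) l \<approx> a * c l"
        using c(2) by (simp add: hom_value_simps cong_mult)
      ultimately have "P (scale a f) (\<lambda>k. a * c k)" unfolding P_def ..
      then show "scale a f \<in> ?S" by blast
      assume "g \<in> ?S"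
      then obtain c' where c': "g - comb d c' \<in> J" "\<forall>l<N. hom_value g l \<approx> c' l"
        unfolding P_def by blast
      have "(f + g) - comb d (\<lambda>k. c k + c' k) \<in> J"
        unfolding comb_add[symmetric]
        using pm.subspace_add[OF sub c(1) c'(1)] by (simp add: algebra_simps)
      moreover have "\<forall>l<N. hom_value (f + g) l \<approx> c l + c' l"
        using c(2) c'(2) by (simp add: hom_value_simps cong_add)
      ultimately have "P (f + g) (\<lambda>k. c k + c' k)" unfolding P_def ..
      then show "f + g \<in> ?S" by blast
    qed
    fix u :: "'n hvar \<Rightarrow>\<^sub>0 nat" assume u: "mdeg u = d"
    have u_eq: "u = Poly_Mapping.single Z (Poly_Mapping.lookup u Z) + x_exponent (x_word u)"
    proof (rule poly_mapping_eqI)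
      show "Poly_Mapping.lookup u y = Poly_Mapping.lookup
          (Poly_Mapping.single Z (Poly_Mapping.lookup u Z) + x_exponent (x_word u)) y" for y
        by (cases y) (simp_all add: lookup_add lookup_single count_x_word)
    qed
    then have len: "d = Poly_Mapping.lookup u Z + length (x_word u)"
      using u by (metis mdeg_add mdeg_single mdeg_x_exponent)
    then obtain c where "mon u - comb d c \<in> J" "\<forall>l<N. act (x_word u) l \<approx> c l"
      using word_coordinates[of "x_word u"] u_eq by auto
    then have "P (mon u) c" by (simp add: P_def hom_value_def monomial_value_def)
    then show "mon u \<in> ?S" by blast
  qed
  then obtain c' where c': "f - comb d c' \<in> J" "\<forall>l<N. hom_value f l \<approx> c' l"
    using f unfolding P_def by blast
  have "comb d (\<lambda>k. c k - c' k) \<in> J"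
    using pm.subspace_diff[OF sub c'(1) c] by (simp flip: comb_diff)
  then have "c l - c' l = 0" by (rule coordinates_unique[OF _ l])
  then show ?thesis using c'(2) l by simp
qed

lemma hom_value_basis:
  assumes "j < N" "l < N"
  shows "hom_value (H d j) l \<approx> (if l = j then 1 else 0)"
proof (rule hom_value_coordinates)
  show "H d j \<in> hom_comm_part d" using basis assms(1) by (auto simp: is_basis_def generates_def)
  have "comb d (\<lambda>k. if k = j then 1 else 0) = (\<Sum>k<N. if k = j then H d k else 0)"
    by (intro sum.cong) auto
  then show "H d j - comb d (\<lambda>k. if k = j then 1 else 0) \<in> J"
    using assms(1) by (simp add: pm.subspace_0[OF sub])
qed (rule assms)

text \<open>
  The generators of \<open>J\<close> have degree \<open>d\<close>, where the value of an element is its vector of coordinates,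
  and the coordinates of an element of \<open>J\<close> are zero.
\<close>

lemma hom_value_mem:
  assumes G: "generated_in_degree d J" and f: "f \<in> J" and l: "l < N"
  shows "hom_value f l \<in> A"
proof -
  obtain G where G: "G \<subseteq> hom_comm_part d" "J = ideal_gen G"
    using G by (auto simp: generated_in_degree_def)
  have "hom_value g l \<in> A" if "g \<in> G" "l < N" for g l
  proof -
    have "g \<in> J" using that G ideal_gen_superset by blast
    then have "g - comb d (\<lambda>_. 0) \<in> J" by simp
    from hom_value_coordinates[OF _ this that(2)] that(1) G(1) show ?thesis
      by (auto simp: cong_zero_iff)
  qed
  then have "G \<subseteq> {f. \<forall>l<N. hom_value f l \<in> A}" by blast
  from ideal_gen_minimal[OF this left_ideal_hom_value]
  have "J \<subseteq> {f. \<forall>l<N. hom_value f l \<in> A}" by (simp only: G(2)[symmetric])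
  then show ?thesis using f l by blast
qed

end

section \<open>Bases of a quotient of the free algebra\<close>

lemma sum_mult_delta:
  fixes f :: "nat \<Rightarrow> 'a::semiring_1"
  assumes "k < n"
  shows "(\<Sum>j<n. f j * (if j = k then 1 else 0)) = f k"
    and "(\<Sum>j<n. f j * (if k = j then 1 else 0)) = f k"
proof -
  have "(\<Sum>j<n. f j * (if j = k then 1 else 0)) = (\<Sum>j<n. if j = k then f j else 0)"
    by (intro sum.cong) auto
  then show "(\<Sum>j<n. f j * (if j = k then 1 else 0)) = f k" using assms by simp
  then show "(\<Sum>j<n. f j * (if k = j then 1 else 0)) = f k" by (simp add: eq_commute[of k])
qed

text \<open>
  Here the coordinates are exact: the action of words through the matrices of left multiplication,
  started at the coordinates of \<open>1\<close>, is the coordinate map.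
\<close>

locale free_algebra_basis =
  fixes I :: "('n::finite, 'a::comm_ring_1) free_alg set" and \<beta>h :: "'n fword list"
  assumes left_ideal_I: "left_ideal I"
    and free_basis: "is_basis scale UNIV I (map mon \<beta>h)"
begin

abbreviation n :: nat where "n \<equiv> length \<beta>h"

definition T :: "'n \<Rightarrow> nat \<Rightarrow> nat \<Rightarrow> 'a" where
  "T i l k = mult_matrix I \<beta>h i $$ (l, k)"

definition one_coords :: "nat \<Rightarrow> 'a" where
  "one_coords = (SOME c. mon 0 - (\<Sum>l<n. scale (c l) (mon (\<beta>h ! l))) \<in> I)"

abbreviation coords :: "('n, 'a) free_alg \<Rightarrow> nat \<Rightarrow> 'a" where
  "coords f l \<equiv> linear_extension (\<lambda>w. word_action n T (letters w) one_coords l) f"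

lemma subspace_I: "pm.subspace I"
  by (rule subspace_left_ideal[OF left_ideal_I])

lemma mult_matrix_carrier: "mult_matrix I \<beta>h i \<in> carrier_mat n n"
  unfolding mult_matrix_def
  using pm.matrix_in_basis(1)[OF subspace_I free_basis] by simp

lemma T_spec: "k < n \<Longrightarrow> free_var i * mon (\<beta>h ! k) - (\<Sum>l<n. scale (T i l k) (mon (\<beta>h ! l))) \<in> I"
  unfolding T_def mult_matrix_def
  using pm.matrix_in_basis(2)[OF subspace_I free_basis, of "\<lambda>f. free_var i * f" k] by simp

lemma commutator_ideal_eq:
  "commutator_ideal n (mult_matrix I \<beta>h)
     = ideal_gen {(\<Sum>j<n. T i l j * T i' j k) - (\<Sum>j<n. T i' l j * T i j k) | i i' l k. l < n \<and> k < n}"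
proof -
  have "(mult_matrix I \<beta>h i * mult_matrix I \<beta>h j - mult_matrix I \<beta>h j * mult_matrix I \<beta>h i) $$ (a, b)
      = (\<Sum>k<n. T i a k * T j k b) - (\<Sum>k<n. T j a k * T i k b)" if "a < n" "b < n" for i j a b
    using that carrier_matD[OF mult_matrix_carrier]
    by (simp add: scalar_prod_def T_def atLeast0LessThan)
  then have "(x = (mult_matrix I \<beta>h i * mult_matrix I \<beta>h j - mult_matrix I \<beta>h j * mult_matrix I \<beta>h i) $$ (a, b)
        \<and> a < n \<and> b < n)
      \<longleftrightarrow> (x = (\<Sum>k<n. T i a k * T j k b) - (\<Sum>k<n. T j a k * T i k b) \<and> a < n \<and> b < n)"
    for x i j a b
    by (cases "a < n"; cases "b < n") simp_all
  then show ?thesis unfolding commutator_ideal_def by (simp only:)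
qed

lemma coords_correct: "f - (\<Sum>l<n. scale (coords f l) (mon (\<beta>h ! l))) \<in> I"
proof (induction f rule: poly_mapping_add_induct)
  case zero
  show ?case by (simp add: pm.subspace_0[OF subspace_I])
next
  case (add f g)
  from pm.subspace_add[OF subspace_I add] show ?case
    by (simp add: linear_extension_add pm.scale_left_distrib sum.distrib algebra_simps)
next
  case (single w c)
  have "mon (Word w) - (\<Sum>l<n. scale (word_action n T w one_coords l) (mon (\<beta>h ! l))) \<in> I" for w
  proof (induction w)
    case Nil
    have "\<exists>c. mon 0 - (\<Sum>l<n. scale (c l) (mon (\<beta>h ! l))) \<in> I"
      using free_basis unfolding is_basis_def generates_def lincomb_def by fastforce
    from someI_ex[OF this] show ?case by (simp add: one_coords_def zero_fword_def)
  next
    case (Cons i w)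
    let ?c = "word_action n T w one_coords"
    have "free_var i * (mon (Word w) - (\<Sum>l<n. scale (?c l) (mon (\<beta>h ! l)))) \<in> I"
      using left_ideal_I Cons by (simp add: left_ideal_def)
    moreover have "free_var i * mon (Word w) = (mon (Word (i # w)) :: ('n, 'a) free_alg)"
      by (simp add: free_var_def mon_mult plus_fword_def)
    moreover have "free_var i * scale c f = scale c (free_var i * f)" for c and f :: "('n, 'a) free_alg"
      by (simp add: scale_def const_def free_var_def mon_def mult_single flip: mult.assoc)
    ultimately have "mon (Word (i # w)) - (\<Sum>l<n. scale (?c l) (free_var i * mon (\<beta>h ! l))) \<in> I"
      by (simp add: right_diff_distrib sum_distrib_left)
    moreover have "(\<Sum>k<n. scale (?c k) (free_var i * mon (\<beta>h ! k)))
        - (\<Sum>l<n. scale (\<Sum>k<n. ?c k * T i l k) (mon (\<beta>h ! l))) \<in> I"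
      by (intro pm.combination_trans subspace_I T_spec)
    ultimately show ?case
      using pm.subspace_add[OF subspace_I] by (fastforce simp: mult.commute)
  qed
  from pm.subspace_scale[OF subspace_I this[of "letters w"], of c]
  show ?case
    by (simp add: pm.scale_right_diff_distrib scale_mon scale_single pm.scale_sum_right linear_extension_single)
qed

lemma coords_unique:
  assumes "f - (\<Sum>l<n. scale (c l) (mon (\<beta>h ! l))) \<in> I" "l < n"
  shows "coords f l = c l"
proof -
  have "(\<Sum>l<n. scale (c l - coords f l) (mon (\<beta>h ! l))) \<in> I"
    using pm.subspace_diff[OF subspace_I coords_correct[of f] assms(1)]
    by (simp add: pm.scale_left_diff_distrib sum_subtractf)
  then have "c l - coords f l = 0"
    using pm.basis_coordinates_unique[OF free_basis, of "\<lambda>l. c l - coords f l" l] assms(2) by simp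
  then show ?thesis by simp
qed

lemma coords_mem: "f \<in> I \<Longrightarrow> l < n \<Longrightarrow> coords f l = 0"
  by (rule coords_unique[of f "\<lambda>_. 0"]) simp_all

lemma coords_basis:
  assumes "k < n" "l < n"
  shows "word_action n T (letters (\<beta>h ! k)) one_coords l = (if l = k then 1 else 0)"
proof -
  have "(\<Sum>l<n. scale (if l = k then 1 else 0) (mon (\<beta>h ! l))) 
      = (\<Sum>l<n. if l = k then mon (\<beta>h ! l) else 0 :: ('n, 'a) free_alg)"
    by (intro sum.cong) auto
  then have "mon (\<beta>h ! k) - (\<Sum>l<n. scale (if l = k then 1 else 0) (mon (\<beta>h ! l))) \<in> I"
    using assms(1) by (simp add: pm.subspace_0[OF subspace_I])
  from coords_unique[OF this assms(2)] show ?thesis by simp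
qed

end

section \<open>The Fitting ideal and the commutator ideal\<close>

locale lifted_basis = degree_basis J \<beta> d + free_algebra_basis I \<beta>h
  for J :: "('n::finite, 'a::comm_ring_1) hom_comm_poly set" and \<beta> d
    and I :: "('n, 'a) free_alg set" and \<beta>h +
  fixes J' :: "('n, 'a) hom_free_alg set"
  assumes graded: "graded_left_ideal J'"
    and J_image: "J = hom_comm_image ` J'"
    and I_localization: "I = degree_zero_localization J'"
    and lift_length: "length \<beta>h = length \<beta>"
    and lift: "k < length \<beta> \<Longrightarrow> count (mset (letters (\<beta>h ! k))) i = Poly_Mapping.lookup (\<beta> ! k) i"
begin

text \<open>
  Membership in the localization asks for homogeneous representatives, so a general element of \<open>J'\<close> is
  first split into its homogeneous components.
\<close>

lemma dehomogenize_mem: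
  assumes "g \<in> J'"
  shows "dehomogenize g \<in> I"
proof -
  obtain k h where h: "\<And>m. h m \<in> J' \<inter> hom_free_part m" and g: "g = (\<Sum>m<k. h m)"
    using graded assms unfolding graded_left_ideal_def by blast
  have "dehomogenize (h m) \<in> I" for m
    unfolding I_localization using h[of m] by (auto intro: degree_zero_localizationI)
  then show ?thesis unfolding g dehomogenize_sum by (intro pm.subspace_sum subspace_I)
qed

text \<open>
  A relation lifts to \<open>J'\<close>, and the dehomogenization of the lift has zero coordinates. Modulo commutators
  these are the values that the action of words assigns to the relation itself. As \<open>z\<^sup>e l\<close> has the value of
  the word lifting \<open>l\<close>, a unit vector, these values are the entries of the relation.
\<close>

lemma relation_entry_mem_commutator_ideal:
  assumes c: "comb e c \<in> J" and l: "l < N"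
  shows "c l \<in> commutator_ideal N (mult_matrix I \<beta>h)" (is "_ \<in> ?C")
proof -
  interpret C: commuting_action ?C N T one_coords
  proof
    show "left_ideal ?C" unfolding commutator_ideal_def by (rule left_ideal_ideal_gen)
    then interpret ring_ideal ?C by unfold_locales
    show "cong (\<Sum>j<N. T i l j * T i' j k) (\<Sum>j<N. T i' l j * T i j k)"
      if "l < N" "k < N" for l k i i'
      using that ideal_gen_superset commutator_ideal_eq unfolding cong_def lift_length
      by fastforce
  qed
  obtain g where g: "g \<in> J'" "comb e c = hom_comm_image g" using c unfolding J_image by blast
  have "C.free_value (dehomogenize g) l = 0"
    using coords_mem[OF dehomogenize_mem[OF g(1)], of l] l
    by (simp add: C.free_value_def lift_length)
  then have zero: "C.cong 0 (C.hom_value (comb e c) l)"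
    using C.free_value_dehomogenize[OF l, of g] g(2) by simp
  have "C.hom_value (comb e c) l = (\<Sum>k<N. c k * C.hom_value (H e k) l)"
    by (simp add: C.hom_value_simps)
  also have "C.cong \<dots> (\<Sum>k<N. c k * (if l = k then 1 else 0))"
  proof (intro C.cong_sum C.cong_mult C.cong_refl)
    fix k assume "k \<in> {..<N}"
    then have k: "k < N" by simp
    have "C.cong (C.hom_value (H e k) l) (C.act (letters (\<beta>h ! k)) l)"
      using lift[OF k] l by (rule C.hom_value_homogenize_mono)
    then show "C.cong (C.hom_value (H e k) l) (if l = k then 1 else 0)"
      using coords_basis[of k l] k l by (simp add: lift_length)
  qed
  also have "(\<Sum>k<N. c k * (if l = k then 1 else 0)) = c l"
    using l by (simp add: sum_mult_delta)
  finally have "C.cong (C.hom_value (comb e c) l) (c l)" .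
  with zero have "C.cong 0 (c l)" by (rule C.cong_trans)
  then show ?thesis using C.cong_sym C.cong_zero_iff by blast
qed

text \<open>
  Evaluating with \<open>M\<close> the element \<open>t\<^sub>i w\<^sub>k - \<Sum>\<^sub>j T\<^sub>i(j,k) w\<^sub>j\<close> of \<open>I\<close>, where \<open>w\<^sub>j\<close> are the words of the basis, gives the
  difference of the \<open>k\<close>'th columns of \<open>M i\<close> and \<open>T i\<close>, as the words \<open>w\<^sub>j\<close> evaluate to unit vectors. The element is
  the dehomogenization of an element of \<open>J'\<close> whose image in \<open>J\<close> has value zero. So \<open>M i\<close> and \<open>T i\<close> are congruent.
\<close>

lemma commutator_ideal_subset:
  assumes A: "left_ideal A" and rel: "\<And>c l. comb (Suc d) c \<in> J \<Longrightarrow> l < N \<Longrightarrow> c l \<in> A"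
    and gen: "generated_in_degree d J"
  shows "commutator_ideal N (mult_matrix I \<beta>h) \<subseteq> A"
proof -
  interpret A: degree_basis_modulo J \<beta> d A
  proof
    show "left_ideal A" by (rule A)
    show "c l \<in> A" if "comb (Suc d) c \<in> J" "l < N" for c l using that by (rule rel)
  qed
  have act_basis: "A.cong (A.act (letters (\<beta>h ! k)) l) (if l = k then 1 else 0)"
    if kl: "k < N" "l < N" for k l
  proof -
    have "A.cong (A.act (letters (\<beta>h ! k)) l) (A.hom_value (H d k) l)"
      using A.hom_value_homogenize_mono[OF lift[OF kl(1)] kl(2)] by (rule A.cong_sym)
    also have "A.cong \<dots> (if l = k then 1 else 0)" by (rule A.hom_value_basis[OF kl])
    finally show ?thesis .
  qed
  have M_T: "A.cong (M i l k) (T i l k)" if kl: "k < N" "l < N" for i k l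
  proof -
    let ?f = "free_var i * mon (\<beta>h ! k) - (\<Sum>j<n. scale (T i j k) (mon (\<beta>h ! j)))"
    have "?f \<in> I" using T_spec[of k i] kl(1) by (simp add: lift_length)
    then obtain g where g: "g \<in> J'" "?f = dehomogenize g"
      unfolding I_localization degree_zero_localization_def by blast
    have "A.cong (A.free_value ?f l) (A.hom_value (hom_comm_image g) l)"
      unfolding g(2) by (rule A.free_value_dehomogenize[OF kl(2)])
    also have "A.cong \<dots> 0"
      unfolding A.cong_zero_iff using g(1) kl(2) by (intro A.hom_value_mem gen) (simp_all add: J_image)
    finally have zero: "A.cong (A.free_value ?f l) 0" .
    have "free_var i * mon (\<beta>h ! k) = (mon (Word (i # letters (\<beta>h ! k))) :: ('n, 'a) free_alg)"
      by (simp add: free_var_def mon_mult plus_fword_def)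
    then have val: "A.free_value ?f l = (\<Sum>j<N. M i l j * A.act (letters (\<beta>h ! k)) j)
        - (\<Sum>j<N. T i j k * A.act (letters (\<beta>h ! j)) l)" (is "_ = ?E")
      by (simp add: A.free_value_simps lift_length)
    have "A.cong ?E ((\<Sum>j<N. M i l j * (if j = k then 1 else 0))
        - (\<Sum>j<N. T i j k * (if l = j then 1 else 0)))"
      by (rule A.cong_diff; rule A.cong_sum; rule A.cong_mult[OF A.cong_refl act_basis])
        (simp_all add: kl)
    then have "A.cong (A.free_value ?f l) (M i l k - T i l k)"
      unfolding val using kl by (simp add: sum_mult_delta)
    from A.cong_trans[OF A.cong_sym[OF this] zero] show ?thesis
      unfolding A.cong_def by simp
  qed
  have "A.cong (\<Sum>j<N. T i l j * T i' j k) (\<Sum>j<N. T i' l j * T i j k)"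
    if lk: "l < N" "k < N" for i i' l k
  proof -
    have "A.cong (\<Sum>j<N. T i l j * T i' j k) (\<Sum>j<N. M i l j * M i' j k)"
      using lk by (intro A.cong_sum A.cong_mult A.cong_sym[OF M_T]) auto
    also have "A.cong \<dots> (\<Sum>j<N. M i' l j * M i j k)" by (rule A.commute[OF lk])
    also have "A.cong \<dots> (\<Sum>j<N. T i' l j * T i j k)"
      using lk by (intro A.cong_sum A.cong_mult M_T) auto
    finally show ?thesis .
  qed
  then show ?thesis
    unfolding commutator_ideal_eq[unfolded lift_length] A.cong_def
    by (intro ideal_gen_minimal A) auto
qed

text \<open>
  Multiplying a relation of degree \<open>d + 1\<close> by powers of \<open>z\<close> gives a relation with the same entries in any higher degree, so
  the entries of relations in degree \<open>d + 1 + m\<close> include those in degree \<open>d + 1\<close>.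
\<close>

lemma fitting_ideal_eq_commutator_ideal:
  assumes "generated_in_degree d J"
  shows "fitting_ideal scale (hom_comm_part (d + Suc m)) J (int N - 1)
       = commutator_ideal N (mult_matrix I \<beta>h)" (is "_ = ?C")
proof -
  let ?bs = "map (homogenize_mono (d + Suc m)) \<beta>"
  define X where "X = {c $ j | c j. c \<in> relations scale J ?bs \<and> j < N}"
  have fit: "fitting_ideal scale (hom_comm_part (d + Suc m)) J (int N - 1) = ideal_gen X"
    using pm.fitting_ideal_pred_generators[OF sub generates_above[of "Suc m"]] by (simp add: X_def)
  have "X \<subseteq> ?C"
    using relation_entry_mem_commutator_ideal[where e = "d + Suc m"] unfolding X_def
    by (auto simp: pm.relations_iff)
  then have "ideal_gen X \<subseteq> ?C"
    by (rule ideal_gen_minimal) (simp add: commutator_ideal_def left_ideal_ideal_gen)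
  moreover have "?C \<subseteq> ideal_gen X"
  proof (rule commutator_ideal_subset[OF left_ideal_ideal_gen _ assms])
    fix c l assume c: "comb (Suc d) c \<in> J" and l: "l < N"
    have "comb (d + Suc m) c \<in> J"
    proof (induction m)
      case (Suc m)
      then show ?case using comb_Suc[of "d + Suc m" c] mult_mem_J[of _ "var Z"] by simp
    qed (use c in simp)
    then have "vec N c \<in> relations scale J ?bs" using pm.relations_vec_iff[of ?bs c J] by simp
    then have "vec N c $ l \<in> X" unfolding X_def using l by blast
    then show "c l \<in> ideal_gen X" using l ideal_gen_superset[of X] by auto
  qed
  ultimately show ?thesis unfolding fit by (rule equalityI)
qed

end

theorem proposition5p7:
  fixes \<beta> :: "'n::finite monomial list"
    and \<beta>h :: "'n fword list"
    and J' :: "('n, 'a::comm_ring_1) hom_free_alg set"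
    and J :: "('n, 'a) hom_comm_poly set"
    and I :: "('n, 'a) free_alg set"
    and N d m :: nat
  assumes "contains_divisors \<beta>"
    and "N = length \<beta>"
    and "d \<ge> max_deg \<beta> + 1"
    and "is_lift TYPE('a) \<beta>h \<beta>"
    and "graded_left_ideal J'"
    and "J = hom_comm_image ` J'"
    and "I = degree_zero_localization J'"
    and "generated_in_degree d J"
    and "is_basis scale (hom_comm_part d) J (map (homogenize_mono d) \<beta>)"
    and "is_basis scale UNIV I (map mon \<beta>h)"
    and "m \<ge> 1"
  shows "fitting_ideal scale (hom_comm_part (d + m)) J (int N - 1)
         = commutator_ideal N (mult_matrix I \<beta>h)"
proof -
  interpret lifted_basis J \<beta> d I \<beta>h J'
  proof
    show "left_ideal J"
      using assms(8) left_ideal_ideal_gen unfolding generated_in_degree_def by blast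
    show "mdeg l < d" if "l \<in> set \<beta>" for l
      using mdeg_le_max_deg[OF that] assms(3) by simp
    show "left_ideal I"
      unfolding assms(7) using assms(5)
      by (intro left_ideal_degree_zero_localization) (simp add: graded_left_ideal_def)
    show "length \<beta>h = length \<beta>"
      using assms(4) unfolding is_lift_def by (rule list_all2_lengthD)
    show "count (mset (letters (\<beta>h ! k))) i = Poly_Mapping.lookup (\<beta> ! k) i" if "k < length \<beta>" for k i
      using assms(4) that unfolding is_lift_def list_all2_conv_all_nth comm_image_mon_eq_mon_iff by simp
  qed (use assms in auto)
  obtain m' where "m = Suc m'" using assms(11) by (cases m) auto
  then show ?thesis using fitting_ideal_eq_commutator_ideal[OF assms(8)] assms(2) by simp
qed

end
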